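(* Let $s_0>0$, $v^0\in\dot H^{s_0}$, $T>0$, and fix $\sigma$ with $0<\sigma<s_0$. For $m\in\mathbb{N}$ let $v^{(m)}$ be the (global) solution of the Galerkin system described in the context with $v^{(m)}(0)=v^0$. Then there is a subsequence of $(v^{(m)})$ that converges strongly in $L_p([0,T];\dot H^\sigma)$ for every fixed $1<p<\infty$, and weakly-$*$ in $L_\infty([0,T];\dot H^{s_0})$, to a function $v^\infty$; $v^\infty$ is a solution on $[0,T]$ of the system $\partial_t v_k=\tfrac12 ik\sum_{k_1+k_2=k}e^{3ikk_1k_2t}v_{k_1}v_{k_2}$, $k\in\mathbb{Z}_0$, with $v^\infty(0)=v^0$ (in the sense described in the context); $\|v^\infty\|_{L_\infty([0,T];\dot H^{s_0})}\le M_{s_0}$ for a constant $M_{s_0}$ depending only on $\|v^0\|_{\dot H^0}$, $T$, $\|v^0\|_{\dot H^{s_0}}$ and $s_0$; and $\|v^\infty(t)\|_{\dot H^0}=\|v^0\|_{\dot H^0}$ for almost every $t\in[0,T]$.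
   Context: Write $\mathbb{Z}_0=\mathbb{Z}\setminus\{0\}$. For $s\in\mathbb{R}$, $\dot H^s$ denotes the Hilbert space of sequences $v=(v_k)_{k\in\mathbb{Z}_0}$ of complex numbers with $v_{-k}=\overline{v_k}$ and $\|v\|_{\dot H^s}^2=\sum_{k\in\mathbb{Z}_0}|k|^{2s}|v_k|^2<\infty$. A function $v$ is a solution on $[0,T]$ with $v(0)=v^0$ of the system above if $v\in L_\infty([0,T];\dot H^0)$ and for every $k\in\mathbb{Z}_0$ and $t\in[0,T]$, $v_k(t)-v^0_k=\tfrac12 ik\int_0^t\sum_{k_1+k_2=k}e^{3ikk_1k_2\tau}v_{k_1}(\tau)v_{k_2}(\tau)\,d\tau$ (sums over $k_1,k_2\in\mathbb{Z}_0$). For $m\in\mathbb{N}$, $\Pi_m$ is the projection $(\Pi_m\varphi)_k=\varphi_k$ if $|k|\le m$, $=0$ if $|k|>m$. The Galerkin system is $$\partial_t v^{(m)}_k=\tfrac12 ik\Big(\Pi_m\sum_{k_1+k_2=\cdot}e^{3i(\cdot)k_1k_2t}(\Pi_mv^{(m)})_{k_1}(\Pi_mv^{(m)})_{k_2}\Big)_k,\qquad k\in\mathbb{Z}_0,\qquad v^{(m)}(0)=v^0,$$ i.e. for $|k|\le m$ the right side is $\tfrac12 ik\sum_{k_1+k_2=k,\,|k_1|,|k_2|\le m}e^{3ikk_1k_2t}v^{(m)}_{k_1}v^{(m)}_{k_2}$ and for $|k|>m$ it is $0$. Its solutions exist for all $t\ge0$. *)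

theory Defs
  imports "HOL-Analysis.Analysis"
begin

text \<open>Sequences indexed by the nonzero integers are modelled as functions
  int \<Rightarrow> complex; the value at index 0 is ignored everywhere.
  Time-dependent sequences are functions real \<Rightarrow> int \<Rightarrow> complex.\<close>

definition Z0 :: "int set" where "Z0 = {k. k \<noteq> 0}"

definition hs_weight :: "real \<Rightarrow> (int \<Rightarrow> complex) \<Rightarrow> int \<Rightarrow> real" where
  "hs_weight s v k = \<bar>real_of_int k\<bar> powr (2 * s) * (cmod (v k))\<^sup>2"

definition in_hs :: "real \<Rightarrow> (int \<Rightarrow> complex) \<Rightarrow> bool" where
  "in_hs s v \<longleftrightarrow> hs_weight s v summable_on Z0"

definition hs_norm :: "real \<Rightarrow> (int \<Rightarrow> complex) \<Rightarrow> real" where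
  "hs_norm s v = sqrt (\<Sum>\<^sub>\<infinity>k\<in>Z0. hs_weight s v k)"

definition Hdot :: "real \<Rightarrow> (int \<Rightarrow> complex) set" where
  "Hdot s = {v. (\<forall>k\<in>Z0. v (-k) = cnj (v k)) \<and> in_hs s v}"

text \<open>Right-hand side of the Galerkin system (with the projection Pi_m written out).\<close>
definition galerkin_rhs :: "nat \<Rightarrow> (int \<Rightarrow> complex) \<Rightarrow> real \<Rightarrow> int \<Rightarrow> complex" where
  "galerkin_rhs m w t k =
     (if \<bar>k\<bar> \<le> int m then
        (1/2) * \<i> * of_int k *
          (\<Sum>k1 \<in> {k1. k1 \<noteq> 0 \<and> k - k1 \<noteq> 0 \<and> \<bar>k1\<bar> \<le> int m \<and> \<bar>k - k1\<bar> \<le> int m}.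
              exp (3 * \<i> * of_int k * of_int k1 * of_int (k - k1) * of_real t) * w k1 * w (k - k1))
      else 0)"

definition galerkin_solution :: "(int \<Rightarrow> complex) \<Rightarrow> nat \<Rightarrow> (real \<Rightarrow> int \<Rightarrow> complex) \<Rightarrow> bool" where
  "galerkin_solution v0 m u \<longleftrightarrow>
     u 0 = v0 \<and>
     (\<forall>k\<in>Z0. \<forall>t\<ge>0. ((\<lambda>\<tau>. u \<tau> k) has_vector_derivative galerkin_rhs m (u t) t k) (at t within {0..}))"

definition nonlin :: "(real \<Rightarrow> int \<Rightarrow> complex) \<Rightarrow> int \<Rightarrow> real \<Rightarrow> complex" where
  "nonlin v k \<tau> =
     (\<Sum>\<^sub>\<infinity>k1\<in>{k1. k1 \<noteq> 0 \<and> k - k1 \<noteq> 0}.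
        exp (3 * \<i> * of_int k * of_int k1 * of_int (k - k1) * of_real \<tau>) * v \<tau> k1 * v \<tau> (k - k1))"

definition in_Linf :: "real \<Rightarrow> real \<Rightarrow> (real \<Rightarrow> int \<Rightarrow> complex) \<Rightarrow> bool" where
  "in_Linf T s v \<longleftrightarrow>
     (\<forall>k. (\<lambda>t. v t k) \<in> borel_measurable (restrict_space lborel {0..T})) \<and>
     (\<exists>C. AE t in lborel. t \<in> {0..T} \<longrightarrow> v t \<in> Hdot s \<and> hs_norm s (v t) \<le> C)"

definition is_solution :: "real \<Rightarrow> (int \<Rightarrow> complex) \<Rightarrow> (real \<Rightarrow> int \<Rightarrow> complex) \<Rightarrow> bool" where
  "is_solution T v0 v \<longleftrightarrow>
     in_Linf T 0 v \<and>
     (\<forall>k\<in>Z0. \<forall>t\<in>{0..T}.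
        set_integrable lborel {0..t} (nonlin v k) \<and>
        v t k - v0 k = (1/2) * \<i> * of_int k * (LINT \<tau>:{0..t}|lborel. nonlin v k \<tau>))"

definition Lp_converges :: "real \<Rightarrow> real \<Rightarrow> real \<Rightarrow> (nat \<Rightarrow> real \<Rightarrow> int \<Rightarrow> complex) \<Rightarrow> (real \<Rightarrow> int \<Rightarrow> complex) \<Rightarrow> bool" where
  "Lp_converges T \<sigma> p u v \<longleftrightarrow>
     (\<forall>j. AE t in lborel. t \<in> {0..T} \<longrightarrow> in_hs \<sigma> (\<lambda>k. u j t k - v t k)) \<and>
     ((\<lambda>j. \<integral>\<^sup>+ t\<in>{0..T}. ennreal (hs_norm \<sigma> (\<lambda>k. u j t k - v t k) powr p) \<partial>lborel) \<longlonglongrightarrow> 0)"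

definition pairing :: "(int \<Rightarrow> complex) \<Rightarrow> (int \<Rightarrow> complex) \<Rightarrow> complex" where
  "pairing v g = (\<Sum>\<^sub>\<infinity>k\<in>Z0. v k * cnj (g k))"

text \<open>Weak-* convergence in L_infinity([0,T]; dot-H^s), tested against the predual
  L_1([0,T]; dot-H^{-s}).\<close>
definition weakstar_converges :: "real \<Rightarrow> real \<Rightarrow> (nat \<Rightarrow> real \<Rightarrow> int \<Rightarrow> complex) \<Rightarrow> (real \<Rightarrow> int \<Rightarrow> complex) \<Rightarrow> bool" where
  "weakstar_converges T s u v \<longleftrightarrow>
     (\<forall>g :: real \<Rightarrow> int \<Rightarrow> complex.
        (\<forall>k. (\<lambda>t. g t k) \<in> borel_measurable (restrict_space lborel {0..T})) \<and>
        (AE t in lborel. t \<in> {0..T} \<longrightarrow> in_hs (-s) (g t)) \<and>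
        (\<integral>\<^sup>+ t\<in>{0..T}. ennreal (hs_norm (-s) (g t)) \<partial>lborel) < \<infinity>
      \<longrightarrow> (\<lambda>j. LINT t:{0..T}|lborel. pairing (u j t) (g t))
            \<longlonglongrightarrow> (LINT t:{0..T}|lborel. pairing (v t) (g t)))"

end

theory Submission
  imports Defs "HOL-Complex_Analysis.Great_Picard"
begin

text \<open>
  Writing \<open>\<phi>(k) = k |k|\<^bsup>2s\<^esup>\<close>, the time derivative of the \<open>H\<^sup>s\<close> energy of a Galerkin solution is a
  sum over triads \<open>a + b + c = 0\<close> with coefficient \<open>\<phi>(a) + \<phi>(b) + \<phi>(c)\<close> and phase
  \<open>exp (- 3iabct)\<close>. Integrating the phase by parts replaces the energy by the energy minus a cubic
  correction with coefficient \<open>(\<phi>(a) + \<phi>(b) + \<phi>(c)) / (9abc)\<close>, and leaves a quartic remainder.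
  Because \<open>\<phi>\<close> is odd, the coefficient gains the smallest frequency; hence the correction is at most half
  the energy plus a constant, and the remainder is bounded by the mass times the energy, via Hilbert's
  inequality with kernel \<open>1 / max\<close>. Gronwall then gives a bound uniform in the cutoff. For \<open>s = 0\<close> the
  coefficient vanishes, which is conservation of mass.

  Every mode is Lipschitz in time uniformly in the cutoff, so a subsequence converges pointwise in
  time and frequency. The uniform \<open>H\<^sup>s\<close> bound makes the tails of all series involved uniformly small, so
  that pointwise convergence passes to sums, and dominated convergence passes to time integrals.
\<close>

section \<open>Estimates for triads and quadruples of frequencies\<close>

text \<open>The nonlinearity carries the factor \<open>k\<close>, a full derivative, so estimating
  the energy derivative directly does not close for small \<open>s\<close>. The remedy is the
  absence of resonant triads: \<open>a\<close>, \<open>b\<close>, \<open>c\<close> are nonzero, so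
  the phase frequency \<open>3abc\<close> never vanishes and may be divided by. Moving the time
  derivative onto a mode brings back only one factor \<open>c\<close>, which the gained smallest
  frequency compensates. Quartic phases can be stationary, so the remainder is estimated by absolute
  values, without a second integration by parts.

  The cubic correction is small only at high frequencies. A threshold \<open>R\<close> separates the
  triads: those reaching \<open>R\<close> cost a fraction of order \<open>1 / R\<close> of the
  energy, the others a constant of size \<open>R powr (2 * s)\<close>; \<open>R\<close> is then
  taken large in terms of the conserved mass.

  The initial value is not truncated. Modes above the cutoff stay frozen at their initial values,
  which adds the initial norm to the bound. Reality is not part of the notion of Galerkin solution
  and is derived before the energy identity, which needs \<open>u k * u (- k)\<close> to be the
  squared modulus.\<close>

definition phi :: "real \<Rightarrow> int \<Rightarrow> real" where
  "phi s k = of_int k * \<bar>of_int k\<bar> powr (2 * s)"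

lemma phi_minus [simp]: "phi s (- k) = - phi s k"
  by (simp add: phi_def)

lemma powr_diff_le:
  fixes x y p :: real
  assumes "0 < y" "y \<le> x" "p \<ge> 1"
  shows "x powr p - y powr p \<le> p * (x - y) * x powr (p - 1)"
proof (cases "x = y")
  case False
  then have "y < x" using assms by simp
  have "\<exists>z. y < z \<and> z < x \<and> x powr p - y powr p = (x - y) * (p * z powr (p - 1))"
    using assms by (intro MVT2[OF \<open>y < x\<close>] DERIV_powr[THEN DERIV_cong] has_real_derivative_powr) auto
  then obtain z where z: "y < z" "z < x" "x powr p - y powr p = (x - y) * (p * z powr (p - 1))"
    by blast
  have "z powr (p - 1) \<le> x powr (p - 1)"
    using z assms by (intro powr_mono2) auto
  then have "(x - y) * (p * z powr (p - 1)) \<le> (x - y) * (p * x powr (p - 1))"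
    using assms by (intro mult_left_mono) auto
  then show ?thesis using z by (simp add: mult_ac)
qed simp

lemma phi_diff_le_nonneg:
  assumes "0 \<le> b" "b \<le> a" "s \<ge> 0"
  shows "\<bar>phi s a - phi s b\<bar> \<le> (2 * s + 1) * of_int (a - b) * of_int a powr (2 * s)"
proof (cases "b = 0")
  case True
  have "of_int a * of_int a powr (2 * s) \<le> (2 * s+1) * (of_int a * real_of_int a powr (2 * s))"
    using assms mult_right_mono[of 1 "2 * s+1" "of_int a * real_of_int a powr (2 * s)"] by simp
  then show ?thesis using True assms by (simp add: phi_def mult_ac)
next
  case False
  then have b: "0 < b" using assms by simp
  have *: "phi s k = of_int k powr (2 * s + 1)" if "0 < k" for k
    using that by (simp add: phi_def powr_add)
  have "real_of_int a powr (2 * s+1) \<ge> real_of_int b powr (2 * s+1)"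
    using assms b by (intro powr_mono2) auto
  moreover have "real_of_int a powr (2 * s+1) - real_of_int b powr (2 * s+1)
     \<le> (2 * s+1) * (real_of_int a - real_of_int b) * real_of_int a powr ((2 * s+1) - 1)"
    using assms b by (intro powr_diff_le) auto
  ultimately show ?thesis
    using assms b by (simp add: *)
qed

text \<open>For frequencies of one sign this is the mean value theorem for the power
  \<open>2 * s + 1\<close>, oddness reducing negative ones to positive ones. For opposite signs the
  distance of \<open>a\<close> and \<open>b\<close> is the sum of their moduli, so bounding each
  term by its size is enough.\<close>

lemma phi_diff_le:
  assumes "s \<ge> 0" "\<bar>of_int a\<bar> \<le> N" "\<bar>of_int b\<bar> \<le> N"
  shows "\<bar>phi s a - phi s b\<bar> \<le> (2 * s + 1) * \<bar>of_int (a - b)\<bar> * N powr (2 * s)"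
proof -
  have same: "\<bar>phi s a - phi s b\<bar> \<le> (2 * s + 1) * \<bar>of_int (a - b)\<bar> * N powr (2 * s)"
    if "0 \<le> b" "b \<le> a" "\<bar>of_int a\<bar> \<le> N" for a b
  proof -
    have "of_int a powr (2 * s) \<le> N powr (2 * s)"
      using that assms by (intro powr_mono2) auto
    then have "(2 * s + 1) * of_int (a - b) * of_int a powr (2 * s) \<le> (2 * s + 1) * \<bar>of_int (a - b)\<bar> * N powr (2 * s)"
      using that assms by (intro mult_mono) auto
    then show ?thesis using phi_diff_le_nonneg[OF that(1,2) assms(1)] by linarith
  qed
  have opp: "\<bar>phi s a - phi s b\<bar> \<le> (2 * s + 1) * \<bar>of_int (a - b)\<bar> * N powr (2 * s)"
    if "b < 0" "0 \<le> a" "\<bar>of_int a\<bar> \<le> N" "\<bar>of_int b\<bar> \<le> N" for a b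
  proof -
    have 1: "\<bar>phi s k\<bar> \<le> \<bar>of_int k\<bar> * N powr (2 * s)" if "\<bar>of_int k\<bar> \<le> N" for k
      unfolding phi_def abs_mult using that assms by (auto intro!: mult_left_mono powr_mono2)
    have "\<bar>phi s a - phi s b\<bar> \<le> \<bar>of_int a\<bar> * N powr (2 * s) + \<bar>of_int b\<bar> * N powr (2 * s)"
      using 1[OF that(3)] 1[OF that(4)] by linarith
    also have "\<dots> = 1 * (\<bar>of_int (a - b)\<bar> * N powr (2 * s))"
      using that by (simp add: algebra_simps)
    also have "\<dots> \<le> (2 * s+1) * (\<bar>of_int (a - b)\<bar> * N powr (2 * s))"
      using assms by (intro mult_right_mono) auto
    finally show ?thesis by (simp add: mult_ac)
  qed
  consider "0 \<le> b" "b \<le> a" | "0 \<le> a" "a \<le> b" | "b < 0" "0 \<le> a" | "a < 0" "0 \<le> b"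
    | "a < 0" "b < 0" "a \<le> b" | "a < 0" "b < 0" "b \<le> a"
    by linarith
  then show ?thesis
  proof cases
    case 1 then show ?thesis using same[of b a] assms by auto
  next
    case 2 then show ?thesis using same[of a b] assms by (auto simp: abs_minus_commute)
  next
    case 3 then show ?thesis using opp[of b a] assms by auto
  next
    case 4 then show ?thesis using opp[of a b] assms by (auto simp: abs_minus_commute)
  next
    case 5 then show ?thesis using same[of "-b" "-a"] assms by (auto simp: abs_minus_commute)
  next
    case 6 then show ?thesis using same[of "-a" "-b"] assms by (auto simp: abs_minus_commute)
  qed
qed

text \<open>Oddness turns \<open>phi s b + phi s c\<close> into a difference of values at the points
  \<open>b\<close> and \<open>-c\<close>, whose distance is the modulus of \<open>a\<close>. The
  roles are symmetric, so \<open>a\<close> can later be taken as the smallest of the three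
  frequencies; this is the gain on which everything rests.\<close>

lemma phi_triad_le:
  assumes "s \<ge> 0" "a + b + c = 0" "\<bar>of_int a\<bar> \<le> N" "\<bar>of_int b\<bar> \<le> N" "\<bar>of_int c\<bar> \<le> N"
  shows "\<bar>phi s a + phi s b + phi s c\<bar> \<le> (2 * s + 2) * \<bar>of_int a\<bar> * N powr (2 * s)"
proof -
  have "\<bar>phi s b - phi s (-c)\<bar> \<le> (2 * s + 1) * \<bar>of_int (b - (-c))\<bar> * N powr (2 * s)"
    using assms by (intro phi_diff_le) auto
  also have "b - (-c) = - a" using assms by simp
  finally have 1: "\<bar>phi s b + phi s c\<bar> \<le> (2 * s + 1) * \<bar>of_int a\<bar> * N powr (2 * s)" by simp
  have "\<bar>phi s a\<bar> \<le> \<bar>of_int a\<bar> * N powr (2 * s)"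
    unfolding phi_def abs_mult using assms by (auto intro!: mult_left_mono powr_mono2)
  with 1 show ?thesis by (simp add: algebra_simps) 
qed

text \<open>Young's inequality decouples the two factors; injectivity then turns each half into a product
  of sums.\<close>
lemma pair_sum_le:
  fixes f :: "'k \<Rightarrow> real" and h :: "'j \<Rightarrow> real"
  assumes fin: "finite K" "finite J"
    and maps: "\<alpha> \<in> Q \<rightarrow> K" "\<beta> \<in> Q \<rightarrow> K" "\<gamma> \<in> Q \<rightarrow> J"
    and inj: "inj_on (\<lambda>q. (\<alpha> q, \<gamma> q)) Q" "inj_on (\<lambda>q. (\<beta> q, \<gamma> q)) Q"
    and h: "\<And>j. j \<in> J \<Longrightarrow> 0 \<le> h j"
  shows "(\<Sum>q\<in>Q. f (\<alpha> q) * f (\<beta> q) * h (\<gamma> q)) \<le> (\<Sum>k\<in>K. (f k)\<^sup>2) * (\<Sum>j\<in>J. h j)"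
proof -
  have *: "(\<Sum>q\<in>Q. (f (\<delta> q))\<^sup>2 * h (\<gamma> q)) \<le> (\<Sum>k\<in>K. (f k)\<^sup>2) * (\<Sum>j\<in>J. h j)"
    if "\<delta> \<in> Q \<rightarrow> K" "inj_on (\<lambda>q. (\<delta> q, \<gamma> q)) Q" for \<delta>
  proof -
    have "(\<Sum>q\<in>Q. (f (\<delta> q))\<^sup>2 * h (\<gamma> q)) = (\<Sum>(k, j)\<in>(\<lambda>q. (\<delta> q, \<gamma> q)) ` Q. (f k)\<^sup>2 * h j)"
      using that by (simp add: sum.reindex o_def)
    also have "\<dots> \<le> (\<Sum>(k, j)\<in>K \<times> J. (f k)\<^sup>2 * h j)"
      using fin maps that h by (intro sum_mono2) (auto)
    also have "\<dots> = (\<Sum>k\<in>K. (f k)\<^sup>2) * (\<Sum>j\<in>J. h j)"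
      by (simp add: sum_product sum.cartesian_product)
    finally show ?thesis .
  qed
  have "(\<Sum>q\<in>Q. f (\<alpha> q) * f (\<beta> q) * h (\<gamma> q))
     \<le> (\<Sum>q\<in>Q. ((f (\<alpha> q))\<^sup>2 * h (\<gamma> q) + (f (\<beta> q))\<^sup>2 * h (\<gamma> q)) / 2)"
  proof (intro sum_mono)
    fix q assume "q \<in> Q"
    then have "0 \<le> h (\<gamma> q)" using h maps by auto
    moreover have "f (\<alpha> q) * f (\<beta> q) \<le> ((f (\<alpha> q))\<^sup>2 + (f (\<beta> q))\<^sup>2) / 2"
      using sum_squares_bound[of "f (\<alpha> q)" "f (\<beta> q)"] by simp
    ultimately have "f (\<alpha> q) * f (\<beta> q) * h (\<gamma> q) \<le> ((f (\<alpha> q))\<^sup>2 + (f (\<beta> q))\<^sup>2) / 2 * h (\<gamma> q)"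
      by (rule mult_right_mono[rotated])
    then show "f (\<alpha> q) * f (\<beta> q) * h (\<gamma> q) \<le> ((f (\<alpha> q))\<^sup>2 * h (\<gamma> q) + (f (\<beta> q))\<^sup>2 * h (\<gamma> q)) / 2"
      by (simp add: field_simps)
  qed
  also have "\<dots> = ((\<Sum>q\<in>Q. (f (\<alpha> q))\<^sup>2 * h (\<gamma> q)) + (\<Sum>q\<in>Q. (f (\<beta> q))\<^sup>2 * h (\<gamma> q))) / 2"
    by (simp add: sum.distrib flip: sum_divide_distrib)
  also have "\<dots> \<le> (\<Sum>k\<in>K. (f k)\<^sup>2) * (\<Sum>j\<in>J. h j)"
    using add_mono[OF *[OF maps(1) inj(1)] *[OF maps(2) inj(2)]] by (simp add: mult_ac)
  finally show ?thesis .
qed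

section \<open>Discrete Hilbert inequality and weighted sums over frequencies\<close>

lemma sum_inverse_sqrt_le: "(\<Sum>k=1..n. 1 / sqrt (real k)) \<le> 2 * sqrt (real n)"
proof (induction n)
  case (Suc n)
  have "1 / sqrt (real (Suc n)) \<le> 2 * sqrt (real (Suc n)) - 2 * sqrt (real n)"
  proof -
    have "2 * (sqrt (real (Suc n)) * sqrt (real n)) \<le> real (Suc n) + real n"
      using sum_squares_bound[of "sqrt (real (Suc n))" "sqrt (real n)"] by simp
    then have "1 \<le> (2 * sqrt (real (Suc n)) - 2 * sqrt (real n)) * sqrt (real (Suc n))"
      by (simp add: algebra_simps)
    then show ?thesis by (subst pos_divide_le_eq) auto
  qed
  with Suc show ?case by simp
qed simp

lemma sum_inverse_three_halves_le:
  assumes "1 \<le> n"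
  shows "(\<Sum>k=Suc n..N. 1 / (real k * sqrt (real k))) \<le> 2 / sqrt (real n)"
proof (cases "n \<le> N")
  case True
  \<comment> \<open>Each term is dominated by a telescoping difference; with
    \<open>y^2 - x^2 = 1\<close> the claim becomes a polynomial inequality in the two square
    roots.\<close>
  have step: "1 / (real (Suc k) * sqrt (real (Suc k))) \<le> 2 / sqrt (real k) - 2 / sqrt (real (Suc k))" if "1 \<le> k" for k
  proof -
    define x y where "x = sqrt (real k)" and "y = sqrt (real (Suc k))"
    have xy: "0 < x" "x < y" "y^2 = x^2 + 1" "real (Suc k) = y\<^sup>2" using that by (auto simp: x_def y_def)
    have "1 = (y - x) * (y + x)" using xy by (simp add: algebra_simps power2_eq_square)
    also have "\<dots> \<le> (y - x) * (2 * y)" using xy by (intro mult_left_mono) auto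
    finally have 1: "1 \<le> 2 * y * (y - x)" by (simp add: mult_ac)
    have "x * 1 \<le> y * (2 * y * (y - x))" using 1 xy by (intro mult_mono) auto
    then have "x / (x * (y\<^sup>2 * y)) \<le> (y * (2 * y * (y - x))) / (x * (y\<^sup>2 * y))"
      using xy by (intro divide_right_mono) auto
    also have "\<dots> = 2 / x - 2 / y" using xy(1,2) by (simp add: field_simps power2_eq_square)
    finally have "1 / (y\<^sup>2 * y) \<le> 2 / x - 2 / y" using xy by simp
    then show ?thesis using xy(4) unfolding x_def y_def by metis
  qed
  have "(\<Sum>k=Suc n..N. 1 / (real k * sqrt (real k))) \<le> 2 / sqrt (real n) - 2 / sqrt (real N)"
    using True
  proof (induction N rule: dec_induct)
    case base show ?case by simp
  next
    case (step k)
    then show ?case using \<open>\<And>k. 1 \<le> k \<Longrightarrow> _ k\<close>[of k] assms by simp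
  qed
  moreover have "0 \<le> 2 / sqrt (real N)" by simp
  ultimately show ?thesis by linarith
qed (use assms in auto)

definition freqs :: "nat \<Rightarrow> int set" where
  "freqs m = {k. k \<noteq> 0 \<and> \<bar>k\<bar> \<le> int m}"

lemma finite_freqs [simp]: "finite (freqs m)"
  by (rule finite_subset[of _ "{- int m..int m}"]) (auto simp: freqs_def)

lemma freqs_uminus [simp]: "- k \<in> freqs m \<longleftrightarrow> k \<in> freqs m"
  by (auto simp: freqs_def)

lemma sum_freqs_abs: "(\<Sum>k\<in>freqs m. g (nat \<bar>k\<bar>)) = 2 * (\<Sum>k=1..m. (g k :: real))"
proof -
  have eq: "freqs m = int ` {1..m} \<union> (\<lambda>k. - int k) ` {1..m}"
  proof (intro equalityI subsetI)
    fix k assume k: "k \<in> freqs m"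
    then have "nat \<bar>k\<bar> \<in> {1..m}" by (auto simp: freqs_def)
    moreover have "k = int (nat \<bar>k\<bar>) \<or> k = - int (nat \<bar>k\<bar>)" by auto
    ultimately show "k \<in> int ` {1..m} \<union> (\<lambda>k. - int k) ` {1..m}" by blast
  qed (auto simp: freqs_def)
  have "(\<Sum>k\<in>freqs m. g (nat \<bar>k\<bar>)) =
      (\<Sum>k\<in>int ` {1..m}. g (nat \<bar>k\<bar>)) + (\<Sum>k\<in>(\<lambda>k. - int k) ` {1..m}. g (nat \<bar>k\<bar>))"
    unfolding eq by (rule sum.union_disjoint) auto
  then show ?thesis
    by (simp add: sum.reindex inj_on_def)
qed

text \<open>The row bound for Schur's test with weight \<open>1 / sqrt\<close>. Below
  \<open>n\<close>, the modulus of \<open>d\<close>, the maximum is \<open>n\<close> and the inverse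
  square roots sum to at most \<open>2 * sqrt n\<close>; above it the powers \<open>-3/2\<close> sum
  to at most \<open>2 / sqrt n\<close>. Each part gives \<open>2 / sqrt n\<close>, and the two signs
  of \<open>e\<close> double the total to 8.\<close>

lemma sum_kernel_le:
  assumes d: "d \<in> freqs m"
  shows "(\<Sum>e\<in>freqs m. 1 / (sqrt \<bar>of_int e\<bar> * max \<bar>of_int d\<bar> \<bar>of_int e\<bar>)) \<le> 8 / sqrt \<bar>of_int d\<bar>"
proof -
  define n where "n = nat \<bar>d\<bar>"
  have n: "\<bar>of_int d\<bar> = real n" "1 \<le> n" "n \<le> m" using d by (auto simp: n_def freqs_def)
  have "(\<Sum>e\<in>freqs m. 1 / (sqrt \<bar>of_int e\<bar> * max \<bar>of_int d\<bar> \<bar>of_int e\<bar>)) =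
      (\<Sum>e\<in>freqs m. 1 / (sqrt (real (nat \<bar>e\<bar>)) * max (real n) (real (nat \<bar>e\<bar>))))"
    by (simp add: n)
  also have "\<dots> = 2 * (\<Sum>k=1..m. 1 / (sqrt (real k) * max (real n) (real k)))"
    by (rule sum_freqs_abs)
  also have "(\<Sum>k=1..m. 1 / (sqrt (real k) * max (real n) (real k))) =
     (\<Sum>k=1..n. 1 / (sqrt (real k) * max (real n) (real k))) + (\<Sum>k=Suc n..m. 1 / (sqrt (real k) * max (real n) (real k)))"
    using sum.ub_add_nat[of 1 n "\<lambda>k. 1 / (sqrt (real k) * max (real n) (real k))" "m - n"] n by simp
  also have "(\<Sum>k=1..n. 1 / (sqrt (real k) * max (real n) (real k))) = (\<Sum>k=1..n. 1 / sqrt (real k)) / real n"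
    unfolding sum_divide_distrib by (intro sum.cong) (auto simp: max_def)
  also have "\<dots> \<le> 2 * sqrt (real n) / real n"
    by (intro divide_right_mono sum_inverse_sqrt_le) auto
  also have "\<dots> = 2 / sqrt (real n)"
    using n by (simp add: field_simps)
  also have "(\<Sum>k=Suc n..m. 1 / (sqrt (real k) * max (real n) (real k))) = (\<Sum>k=Suc n..m. 1 / (real k * sqrt (real k)))"
    by (intro sum.cong) (auto simp: max_def mult_ac)
  also have "\<dots> \<le> 2 / sqrt (real n)"
    using n by (intro sum_inverse_three_halves_le) auto
  finally show ?thesis by (simp add: n)
qed

text \<open>Schur's test: Young's inequality with the weight \<open>sqrt\<close> splits each product
  into two terms \<open>S d e\<close> and \<open>S e d\<close>. By symmetry of the kernel both have
  the same double sum, which \<open>sum_kernel_le\<close> bounds row by row.\<close>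

lemma hilbert_kernel_le:
  fixes x :: "int \<Rightarrow> real"
  shows "(\<Sum>(d, e)\<in>freqs m \<times> freqs m. x d * x e / max \<bar>of_int d\<bar> \<bar>of_int e\<bar>) \<le> 8 * (\<Sum>k\<in>freqs m. (x k)\<^sup>2)"
proof -
  define S where "S = (\<lambda>d e. (x d)\<^sup>2 * (sqrt \<bar>of_int d\<bar> / (sqrt \<bar>of_int e\<bar> * max \<bar>of_int d\<bar> \<bar>real_of_int e\<bar>)))"
  have S: "(\<Sum>d\<in>freqs m. \<Sum>e\<in>freqs m. S d e) \<le> 8 * (\<Sum>k\<in>freqs m. (x k)\<^sup>2)"
  proof -
    have "(\<Sum>e\<in>freqs m. S d e) \<le> 8 * (x d)\<^sup>2" if "d \<in> freqs m" for d
    proof -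
      have "(\<Sum>e\<in>freqs m. S d e) = ((x d)\<^sup>2 * sqrt \<bar>of_int d\<bar>) *
          (\<Sum>e\<in>freqs m. 1 / (sqrt \<bar>of_int e\<bar> * max \<bar>of_int d\<bar> \<bar>of_int e\<bar>))"
        by (simp add: S_def sum_distrib_left)
      also have "\<dots> \<le> ((x d)\<^sup>2 * sqrt \<bar>of_int d\<bar>) * (8 / sqrt \<bar>of_int d\<bar>)"
        by (intro mult_left_mono sum_kernel_le that) auto
      also have "\<dots> = 8 * (x d)\<^sup>2" using that by (auto simp: freqs_def)
      finally show ?thesis .
    qed
    then show ?thesis unfolding sum_distrib_left by (intro sum_mono)
  qed
  have pt: "x d * x e / max \<bar>of_int d\<bar> \<bar>of_int e\<bar> \<le> (S d e + S e d) / 2"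
    if "d \<in> freqs m" "e \<in> freqs m" for d e
  proof -
    define p q M where "p = sqrt \<bar>real_of_int d\<bar>" and "q = sqrt \<bar>real_of_int e\<bar>" and "M = max \<bar>real_of_int d\<bar> \<bar>real_of_int e\<bar>"
    have pos: "p > 0" "q > 0" "M > 0" using that by (auto simp: p_def q_def M_def freqs_def)
    have "2 * ((x d * p) * (x e * q)) \<le> (x d * p)\<^sup>2 + (x e * q)\<^sup>2"
      using sum_squares_bound[of "x d * p" "x e * q"] by (simp add: mult_ac)
    then have "2 * ((x d * p) * (x e * q)) / (2 * p * q * M) \<le> ((x d * p)\<^sup>2 + (x e * q)\<^sup>2) / (2 * p * q * M)"
      using pos by (intro divide_right_mono) auto
    also have "2 * ((x d * p) * (x e * q)) / (2 * p * q * M) = x d * x e / M" using pos by simp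
    also have "((x d * p)\<^sup>2 + (x e * q)\<^sup>2) / (2 * p * q * M) =
         ((x d)\<^sup>2 * (p / (q * M)) + (x e)\<^sup>2 * (q / (p * M))) / 2"
      using pos by (simp add: field_simps power2_eq_square)
    finally show ?thesis unfolding S_def p_def q_def M_def by (simp add: max.commute)
  qed
  have "(\<Sum>(d, e)\<in>freqs m \<times> freqs m. x d * x e / max \<bar>of_int d\<bar> \<bar>of_int e\<bar>) =
     (\<Sum>d\<in>freqs m. \<Sum>e\<in>freqs m. x d * x e / max \<bar>of_int d\<bar> \<bar>of_int e\<bar>)"
    by (simp add: sum.cartesian_product)
  also have "\<dots> \<le> (\<Sum>d\<in>freqs m. \<Sum>e\<in>freqs m. (S d e + S e d) / 2)"
    by (intro sum_mono pt)
  also have "\<dots> = ((\<Sum>d\<in>freqs m. \<Sum>e\<in>freqs m. S d e) + (\<Sum>d\<in>freqs m. \<Sum>e\<in>freqs m. S e d)) / 2"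
    by (simp add: sum.distrib flip: sum_divide_distrib)
  also have "(\<Sum>d\<in>freqs m. \<Sum>e\<in>freqs m. S e d) = (\<Sum>d\<in>freqs m. \<Sum>e\<in>freqs m. S d e)"
    by (rule sum.swap)
  finally show ?thesis using S by simp
qed

lemma sum_over_abs_le: "(\<Sum>k\<in>freqs m. x k / \<bar>of_int k\<bar>) \<le> 2 * sqrt (\<Sum>k\<in>freqs m. (x k)\<^sup>2)"
proof -
  \<comment> \<open>Since \<open>1 / 0 = 0\<close>, the bound at \<open>n = 0\<close> reads
    \<open>0 <= 2\<close>, and telescoping only starts at the step from 1 to 2.\<close>
  have sq: "(\<Sum>k=1..n. 1 / (real k)\<^sup>2) \<le> 2 - 1 / real n" for n
  proof (induction n)
    case (Suc n)
    have "1 / (real (Suc n))\<^sup>2 \<le> 1 / real n - 1 / real (Suc n)" if "n \<noteq> 0"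
      using that by (simp add: divide_simps power2_eq_square)
    with Suc show ?case by (cases "n = 0") auto
  qed simp
  have "(\<Sum>k\<in>freqs m. (1 / \<bar>real_of_int k\<bar>)\<^sup>2) = (\<Sum>k\<in>freqs m. 1 / (real (nat \<bar>k\<bar>))\<^sup>2)"
    by (simp add: power_divide)
  also have "\<dots> = 2 * (\<Sum>k=1..m. 1 / (real k)\<^sup>2)" by (rule sum_freqs_abs)
  also have "\<dots> \<le> 4" using sq[of m] by (smt (verit) divide_nonneg_nonneg of_nat_0_le_iff)
  finally have 4: "(\<Sum>k\<in>freqs m. (1 / \<bar>real_of_int k\<bar>)\<^sup>2) \<le> 4" .
  have "(\<Sum>k\<in>freqs m. x k * (1 / \<bar>of_int k\<bar>))\<^sup>2 \<le> (\<Sum>k\<in>freqs m. (x k)\<^sup>2) * (\<Sum>k\<in>freqs m. (1 / \<bar>real_of_int k\<bar>)\<^sup>2)"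
    by (rule Cauchy_Schwarz_ineq_sum)
  also have "\<dots> \<le> (\<Sum>k\<in>freqs m. (x k)\<^sup>2) * 4"
    by (intro mult_left_mono 4 sum_nonneg) auto
  finally have "(\<Sum>k\<in>freqs m. x k / \<bar>of_int k\<bar>) \<le> sqrt ((\<Sum>k\<in>freqs m. (x k)\<^sup>2) * 4)"
    by (intro real_le_rsqrt) simp
  then show ?thesis by (simp add: real_sqrt_mult)
qed

section \<open>Triads and the bound for the cubic correction\<close>

definition triads :: "nat \<Rightarrow> (int \<times> int \<times> int) set" where
  "triads m = {(a, b, c). a \<in> freqs m \<and> b \<in> freqs m \<and> c \<in> freqs m \<and> a + b + c = 0}"

definition splits :: "nat \<Rightarrow> int \<Rightarrow> int set" where
  "splits m c = {d \<in> freqs m. c - d \<in> freqs m}"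

lemma finite_triads [simp]: "finite (triads m)"
  by (rule finite_subset[of _ "freqs m \<times> freqs m \<times> freqs m"]) (auto simp: triads_def)

lemma finite_splits [simp]: "finite (splits m c)"
  by (simp add: splits_def)

text \<open>One factor 3 in the denominator comes from symmetrising the energy derivative over the
  three slots of a triad, the other, together with \<open>a * b * c\<close>, from the derivative
  \<open>- 3 * \<i> * a * b * c\<close> of the phase.\<close>

definition triad_coeff :: "real \<Rightarrow> int \<Rightarrow> int \<Rightarrow> int \<Rightarrow> real" where
  "triad_coeff s a b c = (phi s a + phi s b + phi s c) / (9 * of_int a * of_int b * of_int c)"

lemma powr_square: "((r::real) powr s)\<^sup>2 = r powr (2 * s)"
  by (simp only: power2_eq_square powr_add[symmetric] mult_2)

text \<open>Distributes the weight of the top frequency over two frequencies comparable to it, one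
  power \<open>s\<close> for each, so that each of the two modes enters through the weighted square
  sum. The comparison constant is 2 for triads and 3 for quadruples.\<close>

lemma powr_pair_le:
  fixes n p q s :: real
  assumes "0 \<le> n" "n \<le> \<kappa> * p" "n \<le> \<kappa> * q" "0 \<le> s" "0 < p" "0 < q" "0 < \<kappa>"
  shows "n powr (2 * s) \<le> (\<kappa>\<^sup>2) powr s * (p * q) powr s"
proof -
  have "n\<^sup>2 \<le> (\<kappa> * p) * (\<kappa> * q)"
    unfolding power2_eq_square using assms by (intro mult_mono) auto
  then have "(n\<^sup>2) powr s \<le> (\<kappa>\<^sup>2 * (p * q)) powr s"
    using assms by (intro powr_mono2) (auto simp: power2_eq_square mult_ac)
  moreover have "(n\<^sup>2) powr s = n powr (2 * s)"
    using assms powr_powr[of n 2 s] by (cases "n = 0") auto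
  ultimately show ?thesis using assms by (simp add: powr_mult)
qed

text \<open>The gained factor \<open>a\<close> cancels against the denominator and leaves the weight
  divided by \<open>B * C\<close>. If the largest frequency is at least \<open>R\<close>, then
  \<open>B * C >= R * A\<close>, which yields the small factor \<open>1 / R\<close>; otherwise the
  weight itself is at most \<open>R powr (2 * s)\<close>. In both cases a factor
  \<open>1 / A\<close> remains to sum over the lowest frequency.\<close>

lemma triad_coeff_le_cubic:
  assumes abc: "a \<noteq> 0" "b \<noteq> 0" "c \<noteq> 0" "a + b + c = 0"
    and s: "0 \<le> s" and R: "0 < R"
    and le: "\<bar>a\<bar> \<le> \<bar>b\<bar>" "\<bar>a\<bar> \<le> \<bar>c\<bar>"
  shows "\<bar>triad_coeff s a b c\<bar> \<le> (2 * s + 2) * 4 powr s *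
     ((\<bar>of_int b\<bar> * \<bar>of_int c\<bar>) powr s / (R * \<bar>of_int a\<bar>) + R powr (2 * s) / \<bar>of_int a\<bar>)"
proof -
  define A B C where "A = \<bar>real_of_int a\<bar>" and "B = \<bar>real_of_int b\<bar>" and "C = \<bar>real_of_int c\<bar>"
  have ABC: "1 \<le> A" "A \<le> B" "A \<le> C" "B \<le> A + C" "C \<le> A + B"
    using abc le by (auto simp: A_def B_def C_def)
  define N where "N = max B C"
  have N: "A \<le> N" "B \<le> N" "C \<le> N" "N \<le> 2 * B" "N \<le> 2 * C" "0 \<le> N" using ABC by (auto simp: N_def)
  have "\<bar>phi s a + phi s b + phi s c\<bar> \<le> (2 * s + 2) * A * N powr (2 * s)"
    unfolding A_def using phi_triad_le[of s a b c N] N s abc by (auto simp: A_def B_def C_def)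
  also have "\<dots> \<le> (2 * s + 2) * A * (4 powr s * (B * C) powr s)"
    using powr_pair_le[of N 2 B C s] N ABC s by (intro mult_left_mono) auto
  finally have 1: "\<bar>phi s a + phi s b + phi s c\<bar> \<le> (2 * s + 2) * A * (4 powr s * (B * C) powr s)" .
  have "\<bar>triad_coeff s a b c\<bar> = \<bar>phi s a + phi s b + phi s c\<bar> / (9 * A * B * C)"
    by (simp add: triad_coeff_def abs_mult A_def B_def C_def)
  also have "\<dots> \<le> ((2 * s + 2) * A * (4 powr s * (B * C) powr s)) / (1 * A * B * C)"
    using ABC s by (intro frac_le 1 mult_right_mono) auto
  also have "\<dots> = (2 * s + 2) * 4 powr s * ((B * C) powr s / (B * C))"
    using ABC by simp
  also have "(B * C) powr s / (B * C) \<le> (B * C) powr s / (R * A) + R powr (2 * s) / A"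
  proof (cases "R \<le> N")
    case True
    have "R * A \<le> B * C"
    proof (cases "B \<le> C")
      case True then show ?thesis using \<open>R \<le> N\<close> ABC R mult_mono[of A B R C] by (auto simp: N_def mult_ac)
    next
      case False then show ?thesis using \<open>R \<le> N\<close> ABC R mult_mono[of R B A C] by (auto simp: N_def mult_ac)
    qed
    then have "(B * C) powr s / (B * C) \<le> (B * C) powr s / (R * A)"
      using R ABC by (intro divide_left_mono) auto
    moreover have "0 \<le> R powr (2 * s) / A" using ABC by auto
    ultimately show ?thesis by linarith
  next
    case False
    then have "B * C \<le> R * R" using ABC by (intro mult_mono) (auto simp: N_def)
    then have "(B * C) powr s \<le> (R * R) powr s" using ABC s by (intro powr_mono2) auto
    also have "\<dots> = R powr (2 * s)" using R by (simp add: powr_mult flip: powr_add)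
    finally have "(B * C) powr s / (B * C) \<le> R powr (2 * s) / A"
      using ABC mult_mono[of A B 1 C] by (intro frac_le) auto
    moreover have "0 \<le> (B * C) powr s / (R * A)" using ABC R by auto
    ultimately show ?thesis by linarith
  qed
  finally show ?thesis
    using s by (simp add: A_def B_def C_def mult_left_mono)
qed

lemma triad_coeff_rotate: "triad_coeff s a b c = triad_coeff s b c a"
  by (simp add: triad_coeff_def add_ac mult_ac)

text \<open>The rotation \<open>\<sigma>\<close> selects which slot carries the lowest frequency.
  Two entries of a triad determine the third, which gives the injectivity for
  \<open>pair_sum_le\<close>.\<close>

lemma triad_sum_le:
  fixes f h :: "int \<Rightarrow> real"
  assumes "\<And>k. k \<in> freqs m \<Longrightarrow> 0 \<le> h k"
    and "(\<sigma> :: int \<times> int \<times> int \<Rightarrow> int \<times> int \<times> int) \<in> {\<lambda>(a,b,c). (a,b,c), \<lambda>(a,b,c). (b,c,a), \<lambda>(a,b,c). (c,a,b)}"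
  shows "(\<Sum>t\<in>triads m. f (fst (snd (\<sigma> t))) * f (snd (snd (\<sigma> t))) * h (fst (\<sigma> t)))
     \<le> (\<Sum>k\<in>freqs m. (f k)\<^sup>2) * (\<Sum>k\<in>freqs m. h k)"
  using assms(2)
  by (intro pair_sum_le[where \<alpha> = "\<lambda>t. fst (snd (\<sigma> t))" and \<beta> = "\<lambda>t. snd (snd (\<sigma> t))"
        and \<gamma> = "\<lambda>t. fst (\<sigma> t)"]) (auto simp: triads_def inj_on_def assms(1))

text \<open>The two high modes are taken in weighted square sums and the lowest one, divided by its
  frequency, in an absolute sum controlled by the mass. The 6 is 3, for the slots that can hold the
  lowest frequency, times the 2 of \<open>sum_over_abs_le\<close>.\<close>

lemma cubic_le:
  assumes s: "0 \<le> s" and R: "0 < R" and x: "\<And>k. k \<in> freqs m \<Longrightarrow> 0 \<le> x k"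
  defines "L \<equiv> (\<Sum>k\<in>freqs m. (x k)\<^sup>2)" and "E \<equiv> (\<Sum>k\<in>freqs m. \<bar>of_int k\<bar> powr (2 * s) * (x k)\<^sup>2)"
  shows "(\<Sum>(a, b, c)\<in>triads m. \<bar>triad_coeff s a b c\<bar> * (x a * x b * x c)) \<le>
    6 * ((2 * s + 2) * 4 powr s) * (E / R + R powr (2 * s) * L) * sqrt L"
proof -
  define K where "K = (2 * s + 2) * 4 powr s"
  have K: "0 \<le> K" using s by (simp add: K_def)
  define y where "y = (\<lambda>k::int. \<bar>of_int k\<bar> powr s * x k)"
  define h where "h = (\<lambda>k. x k / \<bar>of_int k\<bar>)"
  have h0: "0 \<le> h k" if "k \<in> freqs m" for k using x that by (auto simp: h_def)
  have y0: "0 \<le> y k" if "k \<in> freqs m" for k using x that by (auto simp: y_def)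
  have E: "(\<Sum>k\<in>freqs m. (y k)\<^sup>2) = E"
    unfolding E_def y_def by (simp add: power_mult_distrib powr_square)
  define G where "G = (\<lambda>(a, b, c). K * (y b * y c * h a / R + R powr (2 * s) * (x b * x c * h a)))"
  have G0: "0 \<le> G (a, b, c)" if "a \<in> freqs m" "b \<in> freqs m" "c \<in> freqs m" for a b c
    using that K R x y0 h0 by (auto simp: G_def intro!: mult_nonneg_nonneg add_nonneg_nonneg divide_nonneg_nonneg)
  have pt: "\<bar>triad_coeff s a b c\<bar> * (x a * x b * x c) \<le> G (a, b, c)"
    if "a \<in> freqs m" "b \<in> freqs m" "c \<in> freqs m" "a + b + c = 0" "\<bar>a\<bar> \<le> \<bar>b\<bar>" "\<bar>a\<bar> \<le> \<bar>c\<bar>" for a b c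
  proof -
    have "\<bar>triad_coeff s a b c\<bar> * (x a * x b * x c) \<le> (K * ((\<bar>of_int b\<bar> * \<bar>of_int c\<bar>) powr s / (R * \<bar>of_int a\<bar>) + R powr (2 * s) / \<bar>of_int a\<bar>)) * (x a * x b * x c)"
      unfolding K_def using that s R x by (intro mult_right_mono triad_coeff_le_cubic) (auto simp: freqs_def)
    also have "\<dots> = G (a, b, c)"
      by (simp add: G_def y_def h_def powr_mult field_simps)
    finally show ?thesis .
  qed
  \<comment> \<open>Each triad is charged to the rotation that puts a smallest frequency first; the
    other two values of \<open>G\<close> are nonnegative and can be added freely.\<close>
  have pt': "(case t of (a, b, c) \<Rightarrow> \<bar>triad_coeff s a b c\<bar> * (x a * x b * x c)) \<le>
      G ((\<lambda>(a,b,c). (a,b,c)) t) + G ((\<lambda>(a,b,c). (b,c,a)) t) + G ((\<lambda>(a,b,c). (c,a,b)) t)"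
    if "t \<in> triads m" for t
  proof -
    obtain a b c where t: "t = (a, b, c)" by (cases t)
    then have abc: "a \<in> freqs m" "b \<in> freqs m" "c \<in> freqs m" "a + b + c = 0"
      using that by (auto simp: triads_def)
    have eq: "triad_coeff s b c a = triad_coeff s a b c" "triad_coeff s c a b = triad_coeff s a b c" using triad_coeff_rotate by metis+
    consider "\<bar>a\<bar> \<le> \<bar>b\<bar>" "\<bar>a\<bar> \<le> \<bar>c\<bar>" | "\<bar>b\<bar> \<le> \<bar>c\<bar>" "\<bar>b\<bar> \<le> \<bar>a\<bar>" | "\<bar>c\<bar> \<le> \<bar>a\<bar>" "\<bar>c\<bar> \<le> \<bar>b\<bar>" by linarith
    then have "\<bar>triad_coeff s a b c\<bar> * (x a * x b * x c) \<le> G (a, b, c) + G (b, c, a) + G (c, a, b)"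
    proof cases
      case 1 then show ?thesis using pt[of a b c] abc G0[of b c a] G0[of c a b] by simp
    next
      case 2 then show ?thesis using pt[of b c a] abc G0[of a b c] G0[of c a b] eq by (simp add: mult_ac)
    next
      case 3 then show ?thesis using pt[of c a b] abc G0[of a b c] G0[of b c a] eq by (simp add: mult_ac)
    qed
    then show ?thesis by (simp add: t)
  qed
  define Z where "Z = K * (E / R + R powr (2 * s) * L) * (2 * sqrt L)"
  have sumG: "(\<Sum>t\<in>triads m. G (\<sigma> t)) \<le> Z"
    if \<sigma>: "\<sigma> \<in> {\<lambda>(a,b,c). (a,b,c), \<lambda>(a,b,c). (b,c,a), \<lambda>(a,b,c). (c,a,b)}" for \<sigma>
  proof -
    define H where "H = (\<Sum>k\<in>freqs m. h k)"
    have H: "H \<le> 2 * sqrt L" unfolding H_def h_def L_def by (rule sum_over_abs_le)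
    define Y X where "Y = (\<Sum>t\<in>triads m. y (fst (snd (\<sigma> t))) * y (snd (snd (\<sigma> t))) * h (fst (\<sigma> t)))"
      and "X = (\<Sum>t\<in>triads m. x (fst (snd (\<sigma> t))) * x (snd (snd (\<sigma> t))) * h (fst (\<sigma> t)))"
    have "(\<Sum>t\<in>triads m. G (\<sigma> t)) = K * (Y / R + R powr (2 * s) * X)"
      unfolding X_def Y_def sum_divide_distrib sum_distrib_left sum.distrib[symmetric]
      by (intro sum.cong) (auto simp: G_def split_beta)
    also have "\<dots> \<le> K * (E * H / R + R powr (2 * s) * (L * H))"
      using triad_sum_le[OF h0 \<sigma>, where f = y] triad_sum_le[OF h0 \<sigma>, where f = x] R K E
      by (intro mult_left_mono add_mono divide_right_mono) (auto simp: Y_def X_def H_def L_def)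
    also have "\<dots> = K * (E / R + R powr (2 * s) * L) * H" by (simp add: algebra_simps)
    also have "\<dots> \<le> K * (E / R + R powr (2 * s) * L) * (2 * sqrt L)"
      using H K R by (intro mult_left_mono mult_nonneg_nonneg add_nonneg_nonneg divide_nonneg_nonneg)
        (auto simp: E_def L_def intro!: sum_nonneg)
    finally show ?thesis unfolding Z_def .
  qed
  have "(\<Sum>(a, b, c)\<in>triads m. \<bar>triad_coeff s a b c\<bar> * (x a * x b * x c)) \<le>
     (\<Sum>t\<in>triads m. G ((\<lambda>(a,b,c). (a,b,c)) t) + G ((\<lambda>(a,b,c). (b,c,a)) t) + G ((\<lambda>(a,b,c). (c,a,b)) t))"
    by (intro sum_mono pt')
  also have "\<dots> \<le> 3 * Z"
    using sumG[of "\<lambda>(a,b,c). (a,b,c)"] sumG[of "\<lambda>(a,b,c). (b,c,a)"] sumG[of "\<lambda>(a,b,c). (c,a,b)"]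
    by (simp add: sum.distrib)
  finally show ?thesis by (simp add: Z_def K_def mult_ac)
qed

section \<open>Quadruples and the bound for the quartic remainder\<close>

text \<open>The frequencies \<open>p\<close>, \<open>q\<close> are the large pair sharing the
  Sobolev weight; \<open>r\<close>, \<open>t\<close> are the small pair, coupled by the Hilbert
  kernel.\<close>

definition lower_pair :: "real \<Rightarrow> real \<Rightarrow> real \<Rightarrow> real \<Rightarrow> real \<Rightarrow> real" where
  "lower_pair s p q r t = (p * q) powr s / max r t"

lemma lower_pair_nonneg: "0 < r \<Longrightarrow> 0 \<le> lower_pair s p q r t"
  by (simp add: lower_pair_def)

text \<open>The factor 3 arises because in a quadruple of sum zero each frequency is at most the sum
  of the other three, so the second largest is at least a third of the largest.\<close>

lemma lower_pair_ge:
  assumes "0 \<le> s" "0 < n" "n \<le> 3 * p" "n \<le> 3 * q" "0 < p" "0 < q" "0 < r" "0 \<le> C" "C * max r t \<le> 2 * n\<^sup>2"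
  shows "n powr (2 * s) * C / n\<^sup>2 \<le> 2 * 9 powr s * lower_pair s p q r t"
proof -
  have "n powr (2 * s) * (C / n\<^sup>2) \<le> (9 powr s * (p * q) powr s) * (2 / max r t)"
    using assms powr_pair_le[of n 3 p q s] by (intro mult_mono) (auto simp: divide_simps)
  then show ?thesis by (simp add: lower_pair_def mult_ac)
qed

text \<open>The two largest of the four frequencies are comparable, and they carry the whole weight;
  the remaining factor is \<open>1 / max\<close> of the two smaller ones, a Hilbert kernel.\<close>
lemma lower_pair_cases:
  fixes A B D F C s :: real
  assumes s: "0 \<le> s"
    and pos: "0 < A" "0 < B" "0 < D" "0 < F" "0 \<le> C"
    and tri: "C \<le> A + B" "C \<le> D + F" "A \<le> B + D + F" "B \<le> A + D + F" "D \<le> A + B + F" "F \<le> A + B + D"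
  shows "max A B powr (2 * s) * C / (max A B)\<^sup>2 \<le> 2 * 9 powr s *
    (lower_pair s A B D F + lower_pair s D F A B + lower_pair s A D B F + lower_pair s A F B D
     + lower_pair s B D A F + lower_pair s B F A D)"
    (is "?l \<le> _ * (?p1 + ?p2 + ?p3 + ?p4 + ?p5 + ?p6)")
proof -
  define n where "n = max A B"
  have n: "0 < n" "A \<le> n" "B \<le> n" "C \<le> 2 * n" using pos tri by (auto simp: n_def)
  have nn: "C * r \<le> 2 * n\<^sup>2" if "r \<le> n" "0 < r" for r
    using that n pos mult_mono[of C "2 * n" r n] by (simp add: power2_eq_square)
  have nonneg: "0 \<le> ?p1" "0 \<le> ?p2" "0 \<le> ?p3" "0 \<le> ?p4" "0 \<le> ?p5" "0 \<le> ?p6"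
    using pos by (auto intro!: lower_pair_nonneg)
  \<comment> \<open>One case for each choice of the two largest among the four. The larger of the
    two small ones never exceeds \<open>n\<close>, and \<open>C\<close> never exceeds
    \<open>2 * n\<close>, which is what \<open>nn\<close> combines.\<close>
  consider "max D F \<le> min A B" | "max A B \<le> min D F" | "max B F \<le> min A D" | "max B D \<le> min A F"
     | "max A F \<le> min B D" | "max A D \<le> min B F"
    by linarith
  then have "\<exists>P\<in>{?p1, ?p2, ?p3, ?p4, ?p5, ?p6}. ?l \<le> 2 * 9 powr s * P"
  proof cases
    case 1
    have "C * max D F \<le> 2 * n\<^sup>2"
      using 1 n pos tri by (intro nn) (auto simp: n_def)
    then have "?l \<le> 2 * 9 powr s * ?p1"
      unfolding n_def[symmetric] using 1 s n pos tri by (intro lower_pair_ge) (auto simp: n_def)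
    then show ?thesis by blast
  next
    case 2
    have "C * max A B \<le> 2 * n\<^sup>2"
      using 2 n pos tri by (intro nn) (auto simp: n_def)
    then have "?l \<le> 2 * 9 powr s * ?p2"
      unfolding n_def[symmetric] using 2 s n pos tri by (intro lower_pair_ge) (auto simp: n_def)
    then show ?thesis by blast
  next
    case 3
    have "C * max B F \<le> 2 * n\<^sup>2"
      using 3 n pos tri by (intro nn) (auto simp: n_def)
    then have "?l \<le> 2 * 9 powr s * ?p3"
      unfolding n_def[symmetric] using 3 s n pos tri by (intro lower_pair_ge) (auto simp: n_def)
    then show ?thesis by blast
  next
    case 4
    have "C * max B D \<le> 2 * n\<^sup>2"
      using 4 n pos tri by (intro nn) (auto simp: n_def)
    then have "?l \<le> 2 * 9 powr s * ?p4"
      unfolding n_def[symmetric] using 4 s n pos tri by (intro lower_pair_ge) (auto simp: n_def)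
    then show ?thesis by blast
  next
    case 5
    have "C * max A F \<le> 2 * n\<^sup>2"
      using 5 n pos tri by (intro nn) (auto simp: n_def)
    then have "?l \<le> 2 * 9 powr s * ?p5"
      unfolding n_def[symmetric] using 5 s n pos tri by (intro lower_pair_ge) (auto simp: n_def)
    then show ?thesis by blast
  next
    case 6
    have "C * max A D \<le> 2 * n\<^sup>2"
      using 6 n pos tri by (intro nn) (auto simp: n_def)
    then have "?l \<le> 2 * 9 powr s * ?p6"
      unfolding n_def[symmetric] using 6 s n pos tri by (intro lower_pair_ge) (auto simp: n_def)
    then show ?thesis by blast
  qed
  then obtain P where P: "P \<in> {?p1, ?p2, ?p3, ?p4, ?p5, ?p6}" "?l \<le> 2 * 9 powr s * P" by blast
  have "P \<le> ?p1 + ?p2 + ?p3 + ?p4 + ?p5 + ?p6" using P(1) nonneg by auto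
  then have "2 * 9 powr s * P \<le> 2 * 9 powr s * (?p1 + ?p2 + ?p3 + ?p4 + ?p5 + ?p6)"
    by (intro mult_left_mono) auto
  with P(2) show ?thesis by linarith
qed

text \<open>The extra factor \<open>c\<close>, produced by the equation for the mode
  \<open>c\<close>, cancels that factor in the denominator; the gain by the smallest frequency is
  still available. The bound is phrased through \<open>a\<close>, \<open>b\<close> and the size of
  \<open>c\<close> because \<open>c\<close> is about to be replaced by two further
  frequencies.\<close>

lemma triad_coeff_le_quartic:
  assumes abc: "a \<noteq> 0" "b \<noteq> 0" "c \<noteq> 0" "a + b + c = 0" and s: "0 \<le> s"
  shows "\<bar>triad_coeff s a b c\<bar> * \<bar>of_int c\<bar> \<le> 2 * (2 * s + 2) * 4 powr s *
     (max \<bar>of_int a\<bar> \<bar>of_int b\<bar> powr (2 * s) * \<bar>of_int c\<bar> / (max \<bar>of_int a\<bar> \<bar>of_int b\<bar>)\<^sup>2)"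
proof -
  define A B C where "A = \<bar>real_of_int a\<bar>" and "B = \<bar>real_of_int b\<bar>" and "C = \<bar>real_of_int c\<bar>"
  have ABC: "1 \<le> A" "1 \<le> B" "1 \<le> C" "A \<le> B + C" "B \<le> A + C" "C \<le> A + B"
    using abc by (auto simp: A_def B_def C_def)
  define n k where "n = max A B" and "k = min (min A B) C"
  have n2: "\<bar>real_of_int a\<bar> \<le> 2 * n" "\<bar>real_of_int b\<bar> \<le> 2 * n" "\<bar>real_of_int c\<bar> \<le> 2 * n"
    using ABC unfolding n_def A_def B_def C_def by linarith+
  have "\<bar>phi s a + phi s b + phi s c\<bar> \<le> (2 * s + 2) * A * (2 * n) powr (2 * s)"
    unfolding A_def using n2 abc s by (intro phi_triad_le) auto
  moreover have "\<bar>phi s b + phi s a + phi s c\<bar> \<le> (2 * s + 2) * B * (2 * n) powr (2 * s)"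
    unfolding B_def using n2 abc s by (intro phi_triad_le) auto
  moreover have "\<bar>phi s c + phi s a + phi s b\<bar> \<le> (2 * s + 2) * C * (2 * n) powr (2 * s)"
    unfolding C_def using n2 abc s by (intro phi_triad_le) auto
  ultimately have "\<bar>phi s a + phi s b + phi s c\<bar> \<le> (2 * s + 2) * k * (2 * n) powr (2 * s)"
    by (simp add: k_def min_def add_ac)
  also have "(2 * n) powr (2 * s) = 4 powr s * n powr (2 * s)"
    using ABC powr_powr[of "2::real" 2 s] by (simp add: powr_mult n_def)
  finally have S: "\<bar>phi s a + phi s b + phi s c\<bar> \<le> (2 * s + 2) * k * (4 powr s * n powr (2 * s))" .
  have "\<bar>triad_coeff s a b c\<bar> * C = \<bar>phi s a + phi s b + phi s c\<bar> / (9 * (A * B))"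
    using abc by (simp add: triad_coeff_def abs_mult A_def B_def C_def)
  also have "\<dots> \<le> (2 * s + 2) * k * (4 powr s * n powr (2 * s)) / (1 * (A * B))"
    using ABC s S by (intro frac_le mult_right_mono) (auto simp: k_def intro!: mult_nonneg_nonneg)
  also have "\<dots> = (2 * s + 2) * 4 powr s * n powr (2 * s) * (k / (A * B))" by simp
  also have "\<dots> \<le> (2 * s + 2) * 4 powr s * n powr (2 * s) * (2 * C / n\<^sup>2)"
  proof -
    have "k * n\<^sup>2 \<le> 2 * C * (A * B)"
    proof -
      \<comment> \<open>Here \<open>q\<close> and \<open>r\<close> are the larger and smaller of
        \<open>A\<close> and \<open>B\<close>. One uses \<open>q <= 2 * max r C\<close> and that the
        minimum times the maximum of \<open>r\<close> and \<open>C\<close> is their product.\<close>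
      have 1: "p * q\<^sup>2 \<le> 2 * C * (r * q)" if "0 < q" "r \<le> q" "q \<le> r + C" "p = min r C" "0 < r" for p q r
      proof -
        have "p * q \<le> p * (2 * max r C)" using that ABC by (intro mult_left_mono) auto
        also have "\<dots> = 2 * C * r" using that by (auto simp: min_def max_def)
        finally have "p * q * q \<le> 2 * C * r * q" using that by (intro mult_right_mono) auto
        then show ?thesis by (simp add: power2_eq_square mult_ac)
      qed
      show ?thesis
      proof (cases "A \<le> B")
        case True then show ?thesis using 1[of B A k] ABC by (simp add: n_def k_def)
      next
        case False then show ?thesis using 1[of A B k] ABC by (simp add: n_def k_def mult_ac)
      qed
    qed
    moreover have "0 < n" using ABC by (simp add: n_def)
    ultimately have "k / (A * B) \<le> 2 * C / n\<^sup>2" using ABC by (simp add: divide_simps)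
    then show ?thesis using s by (intro mult_left_mono) auto
  qed
  finally show ?thesis
    by (simp add: A_def B_def C_def n_def mult_ac del: distrib_left_numeral distrib_right_numeral)
qed

text \<open>Substituting the equation for the mode \<open>c\<close> splits it into \<open>d\<close>
  and \<open>c - d\<close>, so that \<open>a\<close>, \<open>b\<close>, \<open>d\<close>,
  \<open>c - d\<close> have sum zero.\<close>

definition quads :: "nat \<Rightarrow> ((int \<times> int \<times> int) \<times> int) set" where
  "quads m = Sigma (triads m) (\<lambda>(a, b, c). splits m c)"

text \<open>For each of the six choices of the large pair, the large modes give \<open>E\<close> and
  the small ones, through the Hilbert kernel, \<open>8 * L\<close>. A small pair and one large
  frequency determine the quadruple, as \<open>pair_sum_le\<close> requires. The constant is
  \<open>4 * 6 * 8 = 192\<close>, the 4 collecting the factors 2 of the two pointwise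
  bounds.\<close>

lemma quartic_le:
  assumes s: "0 \<le> s" and x: "\<And>k. k \<in> freqs m \<Longrightarrow> 0 \<le> x k"
  defines "L \<equiv> (\<Sum>k\<in>freqs m. (x k)\<^sup>2)" and "E \<equiv> (\<Sum>k\<in>freqs m. \<bar>of_int k\<bar> powr (2 * s) * (x k)\<^sup>2)"
  shows "(\<Sum>(a, b, c)\<in>triads m. \<bar>triad_coeff s a b c\<bar> * \<bar>of_int c\<bar> * (x a * x b * (\<Sum>d\<in>splits m c. x d * x (c - d)))) \<le>
    192 * ((2 * s + 2) * 4 powr s * 9 powr s) * L * E"
proof -
  define K where "K = 4 * ((2 * s + 2) * 4 powr s * 9 powr s)"
  have K: "0 \<le> K" using s by (simp add: K_def)
  define y where "y = (\<lambda>k::int. \<bar>of_int k\<bar> powr s * x k)"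
  define h where "h = (\<lambda>(r::int, t::int). x r * x t / max \<bar>of_int r\<bar> \<bar>of_int t\<bar>)"
  have E: "(\<Sum>k\<in>freqs m. (y k)\<^sup>2) = E"
    unfolding E_def y_def by (simp add: power_mult_distrib powr_square)
  have h0: "0 \<le> h j" if "j \<in> freqs m \<times> freqs m" for j
    using that x by (auto simp: h_def freqs_def)
  have H: "(\<Sum>j\<in>freqs m \<times> freqs m. h j) \<le> 8 * L"
    unfolding h_def L_def by (rule hilbert_kernel_le)
  have E0: "0 \<le> E" unfolding E_def by (intro sum_nonneg) auto
  have part: "(\<Sum>q\<in>quads m. y (\<alpha> q) * y (\<beta> q) * h (\<gamma> q)) \<le> E * (8 * L)"
    if maps: "\<alpha> \<in> quads m \<rightarrow> freqs m" "\<beta> \<in> quads m \<rightarrow> freqs m" "\<gamma> \<in> quads m \<rightarrow> freqs m \<times> freqs m"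
    and inj: "inj_on (\<lambda>q. (\<alpha> q, \<gamma> q)) (quads m)" "inj_on (\<lambda>q. (\<beta> q, \<gamma> q)) (quads m)" for \<alpha> \<beta> \<gamma>
  proof -
    have "(\<Sum>q\<in>quads m. y (\<alpha> q) * y (\<beta> q) * h (\<gamma> q)) \<le> (\<Sum>k\<in>freqs m. (y k)\<^sup>2) * (\<Sum>j\<in>freqs m \<times> freqs m. h j)"
      using maps inj h0 by (intro pair_sum_le) auto
    also have "\<dots> \<le> E * (8 * L)" unfolding E using H E0 by (intro mult_left_mono)
    finally show ?thesis .
  qed
  have pt: "\<bar>triad_coeff s a b c\<bar> * \<bar>of_int c\<bar> * (x a * x b) * (x d * x (c - d)) \<le>
      K * (y a * y b * h (d, c - d) + y d * y (c - d) * h (a, b) + y a * y d * h (b, c - d)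
        + y a * y (c - d) * h (b, d) + y b * y d * h (a, c - d) + y b * y (c - d) * h (a, d))"
    if q: "((a, b, c), d) \<in> quads m" for a b c d
  proof -
    define e where "e = c - d"
    have fr: "a \<in> freqs m" "b \<in> freqs m" "c \<in> freqs m" "a + b + c = 0" "d \<in> freqs m" "e \<in> freqs m" "c = d + e"
      using q by (auto simp: quads_def triads_def splits_def e_def)
    then have nz: "a \<noteq> 0" "b \<noteq> 0" "c \<noteq> 0" "d \<noteq> 0" "e \<noteq> 0" by (auto simp: freqs_def)
    define A B C D F where "A = \<bar>real_of_int a\<bar>" and "B = \<bar>real_of_int b\<bar>" and "C = \<bar>real_of_int c\<bar>"
      and "D = \<bar>real_of_int d\<bar>" and "F = \<bar>real_of_int e\<bar>"
    define W where "W = lower_pair s A B D F + lower_pair s D F A B + lower_pair s A D B F + lower_pair s A F B D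
     + lower_pair s B D A F + lower_pair s B F A D"
    have "\<bar>triad_coeff s a b c\<bar> * C \<le> 2 * (2 * s + 2) * 4 powr s * (max A B powr (2 * s) * C / (max A B)\<^sup>2)"
      unfolding A_def B_def C_def using fr nz s by (intro triad_coeff_le_quartic) auto
    also have "\<dots> \<le> 2 * (2 * s + 2) * 4 powr s * (2 * 9 powr s * W)"
      unfolding W_def
    proof (intro mult_left_mono lower_pair_cases s)
      have "real_of_int a + real_of_int b + real_of_int c = 0" "real_of_int c = real_of_int d + real_of_int e"
        using fr(4,7) by (metis of_int_add of_int_0)+
      then show "C \<le> A + B" "C \<le> D + F" "A \<le> B + D + F" "B \<le> A + D + F" "D \<le> A + B + F" "F \<le> A + B + D"
        unfolding A_def B_def C_def D_def F_def by linarith+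
    qed (use s nz in \<open>auto simp: A_def B_def C_def D_def F_def\<close>)
    also have "\<dots> = K * W" by (simp add: K_def algebra_simps)
    finally have "\<bar>triad_coeff s a b c\<bar> * C * (x a * x b * (x d * x e)) \<le> K * W * (x a * x b * (x d * x e))"
      using x fr by (intro mult_right_mono) auto
    also have "\<dots> = K * (y a * y b * h (d, e) + y d * y e * h (a, b) + y a * y d * h (b, e)
        + y a * y e * h (b, d) + y b * y d * h (a, e) + y b * y e * h (a, d))"
      by (simp add: W_def lower_pair_def y_def h_def A_def B_def D_def F_def powr_mult algebra_simps)
    finally show ?thesis by (simp add: e_def C_def mult_ac)
  qed
  have "(\<Sum>(a, b, c)\<in>triads m. \<bar>triad_coeff s a b c\<bar> * \<bar>of_int c\<bar> * (x a * x b * (\<Sum>d\<in>splits m c. x d * x (c - d)))) =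
     (\<Sum>((a, b, c), d)\<in>quads m. \<bar>triad_coeff s a b c\<bar> * \<bar>of_int c\<bar> * (x a * x b) * (x d * x (c - d)))"
    unfolding quads_def by (subst sum.Sigma[symmetric]) (auto simp: sum_distrib_left mult_ac intro!: sum.cong)
  also have "\<dots> \<le> (\<Sum>((a, b, c), d)\<in>quads m. K * (y a * y b * h (d, c - d) + y d * y (c - d) * h (a, b) + y a * y d * h (b, c - d)
        + y a * y (c - d) * h (b, d) + y b * y d * h (a, c - d) + y b * y (c - d) * h (a, d)))"
    using pt by (intro sum_mono) auto
  also have "\<dots> = K * ((\<Sum>((a, b, c), d)\<in>quads m. y a * y b * h (d, c - d))
     + (\<Sum>((a, b, c), d)\<in>quads m. y d * y (c - d) * h (a, b))
     + (\<Sum>((a, b, c), d)\<in>quads m. y a * y d * h (b, c - d))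
     + (\<Sum>((a, b, c), d)\<in>quads m. y a * y (c - d) * h (b, d))
     + (\<Sum>((a, b, c), d)\<in>quads m. y b * y d * h (a, c - d))
     + (\<Sum>((a, b, c), d)\<in>quads m. y b * y (c - d) * h (a, d)))"
    by (simp add: split_beta sum.distrib flip: sum_distrib_left)
  also have "\<dots> \<le> K * (E * (8 * L) + E * (8 * L) + E * (8 * L) + E * (8 * L) + E * (8 * L) + E * (8 * L))"
  proof (intro mult_left_mono add_mono K)
    note [simp] = quads_def triads_def splits_def inj_on_def
    show "(\<Sum>((a, b, c), d)\<in>quads m. y a * y b * h (d, c - d)) \<le> E * (8 * L)"
      using part[of "\<lambda>((a,b,c),d). a" "\<lambda>((a,b,c),d). b" "\<lambda>((a,b,c),d). (d, c - d)"] by (force simp: split_beta)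
    show "(\<Sum>((a, b, c), d)\<in>quads m. y d * y (c - d) * h (a, b)) \<le> E * (8 * L)"
      using part[of "\<lambda>((a,b,c),d). d" "\<lambda>((a,b,c),d). c - d" "\<lambda>((a,b,c),d). (a, b)"] by (force simp: split_beta)
    show "(\<Sum>((a, b, c), d)\<in>quads m. y a * y d * h (b, c - d)) \<le> E * (8 * L)"
      using part[of "\<lambda>((a,b,c),d). a" "\<lambda>((a,b,c),d). d" "\<lambda>((a,b,c),d). (b, c - d)"] by (force simp: split_beta)
    show "(\<Sum>((a, b, c), d)\<in>quads m. y a * y (c - d) * h (b, d)) \<le> E * (8 * L)"
      using part[of "\<lambda>((a,b,c),d). a" "\<lambda>((a,b,c),d). c - d" "\<lambda>((a,b,c),d). (b, d)"] by (force simp: split_beta)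
    show "(\<Sum>((a, b, c), d)\<in>quads m. y b * y d * h (a, c - d)) \<le> E * (8 * L)"
      using part[of "\<lambda>((a,b,c),d). b" "\<lambda>((a,b,c),d). d" "\<lambda>((a,b,c),d). (a, c - d)"] by (force simp: split_beta)
    show "(\<Sum>((a, b, c), d)\<in>quads m. y b * y (c - d) * h (a, d)) \<le> E * (8 * L)"
      using part[of "\<lambda>((a,b,c),d). b" "\<lambda>((a,b,c),d). c - d" "\<lambda>((a,b,c),d). (a, d)"] by (force simp: split_beta)
  qed
  finally show ?thesis by (simp add: K_def mult_ac del: distrib_left_numeral distrib_right_numeral)
qed

section \<open>A uniform bound for Galerkin solutions\<close>

lemma gronwall:
  fixes f f' :: "real \<Rightarrow> real"
  assumes f: "\<And>t. 0 \<le> t \<Longrightarrow> (f has_vector_derivative f' t) (at t within {0..})"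
    and le: "\<And>t. 0 \<le> t \<Longrightarrow> t \<le> T \<Longrightarrow> f' t \<le> A * f t"
    and t: "0 \<le> t" "t \<le> T"
  shows "f t \<le> f 0 * exp (A * t)"
proof -
  define g where "g = (\<lambda>\<tau>. f \<tau> * exp (- A * \<tau>))"
  have g: "(g has_real_derivative f' \<tau> * exp (- A * \<tau>) - A * f \<tau> * exp (- A * \<tau>)) (at \<tau> within {0..})" if "0 \<le> \<tau>" for \<tau>
    using f[OF that] unfolding g_def has_real_derivative_iff_has_vector_derivative[symmetric]
    by (auto intro!: derivative_eq_intros)
  have "g 0 \<ge> g t"
  proof (rule DERIV_nonpos_imp_decreasing_open[OF t(1)])
    fix \<tau> assume \<tau>: "0 < \<tau>" "\<tau> < t"
    have "(g has_real_derivative f' \<tau> * exp (- A * \<tau>) - A * f \<tau> * exp (- A * \<tau>)) (at \<tau>)"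
      using g[of \<tau>] \<tau> at_within_open_subset[of \<tau> "{0<..}" "{0..}", OF _ _ Ioi_le_Ico] by auto
    moreover have "f' \<tau> * exp (- A * \<tau>) \<le> A * f \<tau> * exp (- A * \<tau>)"
      using le[of \<tau>] \<tau> t by (intro mult_right_mono) auto
    ultimately show "\<exists>y. (g has_real_derivative y) (at \<tau>) \<and> y \<le> 0" by (meson diff_le_0_iff_le)
  next
    show "continuous_on {0..t} g"
      by (rule continuous_on_subset[of "{0..}"]) (auto intro!: DERIV_continuous_on g)
  qed
  then have "f t * exp (- A * t) * exp (A * t) \<le> f 0 * exp (A * t)"
    by (intro mult_right_mono) (auto simp: g_def)
  then show ?thesis by (simp add: exp_minus field_simps)
qed

text \<open>With \<open>c = - k\<close> this is the phase \<open>exp (3ikabt)\<close> of the Galerkin system.\<close>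
definition osc :: "int \<Rightarrow> int \<Rightarrow> int \<Rightarrow> real \<Rightarrow> complex" where
  "osc a b c t = exp (t *\<^sub>R (- 3 * \<i> * of_int (a * b * c)))"

lemma norm_osc [simp]: "cmod (osc a b c t) = 1"
  by (simp add: osc_def)

lemma cnj_osc: "cnj (osc a b c t) = osc (- a) (- b) (- c) t"
  by (simp add: osc_def exp_cnj)

lemma osc_rotate: "osc b c a t = osc a b c t"
  by (simp add: osc_def mult_ac)

lemma osc_has_vector_derivative:
  "(osc a b c has_vector_derivative osc a b c t * (- 3 * \<i> * of_int (a * b * c))) (at t within S)"
  unfolding osc_def by (rule exp_scaleR_has_vector_derivative_right)

lemma galerkin_rhs_eq:
  assumes "k \<in> freqs m"
  shows "galerkin_rhs m w t k = (1/2) * \<i> * of_int k * (\<Sum>d\<in>splits m k. osc d (k - d) (- k) t * w d * w (k - d))"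
proof -
  have "{k1. k1 \<noteq> 0 \<and> k - k1 \<noteq> 0 \<and> \<bar>k1\<bar> \<le> int m \<and> \<bar>k - k1\<bar> \<le> int m} = splits m k"
    by (auto simp: splits_def freqs_def)
  then show ?thesis using assms
    by (simp add: galerkin_rhs_def freqs_def osc_def scaleR_conv_of_real mult_ac)
qed

lemma galerkin_rhs_eq_0: "\<bar>k\<bar> > int m \<Longrightarrow> galerkin_rhs m w t k = 0"
  by (simp add: galerkin_rhs_def)

lemma splits_reflect: "(\<Sum>d\<in>splits m (- k). f d) = (\<Sum>d\<in>splits m k. f (- d))"
proof (rule sum.reindex_bij_witness[of _ uminus uminus])
  fix d assume "d \<in> splits m k"
  then have "k - d \<in> freqs m" "d \<in> freqs m" by (auto simp: splits_def)
  then show "- d \<in> splits m (- k)" using freqs_uminus[of "k - d" m] by (simp add: splits_def)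
next
  fix d assume "d \<in> splits m (- k)"
  then have "- k - d \<in> freqs m" "d \<in> freqs m" by (auto simp: splits_def)
  then show "- d \<in> splits m k" using freqs_uminus[of "- k - d" m] by (simp add: splits_def add.commute)
qed auto

text \<open>The system is invariant under conjugation combined with reflection of frequencies; this
  symmetry is the basis for propagating reality.\<close>

lemma cnj_galerkin_rhs:
  assumes "k \<in> freqs m"
  shows "cnj (galerkin_rhs m w t (- k)) = galerkin_rhs m (\<lambda>j. cnj (w (- j))) t k"
proof -
  have "- k \<in> freqs m" using assms by simp
  then have "cnj (galerkin_rhs m w t (- k)) = (1/2) * \<i> * of_int k *
     (\<Sum>d\<in>splits m (- k). cnj (osc d (- k - d) k t) * cnj (w d) * cnj (w (- k - d)))"
    by (simp add: galerkin_rhs_eq)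
  also have "(\<Sum>d\<in>splits m (- k). cnj (osc d (- k - d) k t) * cnj (w d) * cnj (w (- k - d)))
     = (\<Sum>d\<in>splits m k. osc d (k - d) (- k) t * cnj (w (- d)) * cnj (w (- (k - d))))"
    unfolding splits_reflect
    by (intro sum.cong) (simp_all add: cnj_osc algebra_simps)
  finally show ?thesis using assms by (simp add: galerkin_rhs_eq)
qed

lemma triads_rotate: "(\<Sum>(a, b, c)\<in>triads m. f a b c) = (\<Sum>(a, b, c)\<in>triads m. f b c a)"
  by (rule sum.reindex_bij_witness[of _ "\<lambda>(a, b, c). (b, c, a)" "\<lambda>(a, b, c). (c, a, b)"])
    (auto simp: triads_def)

text \<open>Testing the equation of mode \<open>k\<close> against mode \<open>- k\<close> produces
  exactly the triads \<open>d + (k - d) + (- k) = 0\<close>.\<close>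

lemma sum_splits_triads:
  "(\<Sum>k\<in>freqs m. \<Sum>d\<in>splits m k. f d (k - d) (- k)) = (\<Sum>(a, b, c)\<in>triads m. f a b c)"
proof -
  have "(\<Sum>k\<in>freqs m. \<Sum>d\<in>splits m k. f d (k - d) (- k)) = (\<Sum>(k, d)\<in>Sigma (freqs m) (splits m). f d (k - d) (- k))"
    by (simp add: sum.Sigma)
  also have "\<dots> = (\<Sum>(a, b, c)\<in>triads m. f a b c)"
  proof (rule sum.reindex_bij_witness[of _ "\<lambda>(a, b, c). (- c, a)" "\<lambda>(k, d). (d, k - d, - k)"])
    fix q assume "q \<in> triads m"
    then obtain a b c where q: "q = (a, b, c)" "a \<in> freqs m" "b \<in> freqs m" "c \<in> freqs m" "a + b + c = 0"
      by (auto simp: triads_def)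
    then have "b = - c - a" by simp
    with q show "(case q of (a, b, c) \<Rightarrow> (- c, a)) \<in> Sigma (freqs m) (splits m)"
      by (simp add: splits_def)
    show "(case case q of (a, b, c) \<Rightarrow> (- c, a) of (k, d) \<Rightarrow> (d, k - d, - k)) = q"
      using q \<open>b = - c - a\<close> by simp
  qed (auto simp: triads_def splits_def)
  finally show ?thesis .
qed

section \<open>A single Galerkin solution: frozen modes and reality\<close>

locale galerkin =
  fixes v0 :: "int \<Rightarrow> complex" and m :: nat and u :: "real \<Rightarrow> int \<Rightarrow> complex"
  assumes sol: "galerkin_solution v0 m u"
    and real0: "k \<noteq> 0 \<Longrightarrow> v0 (- k) = cnj (v0 k)"
begin

lemma initial: "u 0 k = v0 k"
  using sol by (simp add: galerkin_solution_def)

lemma deriv: "k \<noteq> 0 \<Longrightarrow> 0 \<le> t \<Longrightarrow>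
    ((\<lambda>\<tau>. u \<tau> k) has_vector_derivative galerkin_rhs m (u t) t k) (at t within {0..})"
  using sol by (auto simp: galerkin_solution_def Z0_def)

lemma deriv_freqs: "k \<in> freqs m \<Longrightarrow> 0 \<le> t \<Longrightarrow>
    ((\<lambda>\<tau>. u \<tau> k) has_vector_derivative galerkin_rhs m (u t) t k) (at t within {0..})"
  by (rule deriv) (auto simp: freqs_def)

lemma continuous: "k \<noteq> 0 \<Longrightarrow> continuous_on {0..} (\<lambda>t. u t k)"
  unfolding continuous_on_eq_continuous_within
  by (auto intro: has_vector_derivative_continuous deriv)

text \<open>A crude bound by compactness, not uniform in \<open>m\<close>. It only provides the
  local Lipschitz constant for the uniqueness argument.\<close>

lemma bounded_modes: "\<exists>B\<ge>0. \<forall>t\<in>{0..T}. \<forall>k\<in>freqs m. cmod (u t k) \<le> B"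
proof -
  have "\<exists>B. \<forall>t\<in>{0..T}. cmod (u t k) \<le> B" if "k \<in> freqs m" for k
  proof -
    have "compact ((\<lambda>t. u t k) ` {0..T})"
      using that by (intro compact_continuous_image continuous_on_subset[OF continuous]) (auto simp: freqs_def)
    then have "bounded ((\<lambda>t. u t k) ` {0..T})" by (rule compact_imp_bounded)
    then show ?thesis by (auto simp: bounded_iff)
  qed
  then obtain B where B: "\<And>t k. k \<in> freqs m \<Longrightarrow> t \<in> {0..T} \<Longrightarrow> cmod (u t k) \<le> B k" by metis
  have "cmod (u t k) \<le> (\<Sum>k\<in>freqs m. \<bar>B k\<bar>)" if "k \<in> freqs m" "t \<in> {0..T}" for t k
    using B[OF that] member_le_sum[of k "freqs m" "\<lambda>k. \<bar>B k\<bar>"] that by fastforce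
  then show ?thesis by (intro exI[of _ "\<Sum>k\<in>freqs m. \<bar>B k\<bar>"]) (auto intro!: sum_nonneg)
qed

lemma const_mode:
  assumes "\<bar>k\<bar> > int m" "0 \<le> t"
  shows "u t k = v0 k"
proof -
  have "((\<lambda>\<tau>. u \<tau> k) has_vector_derivative 0) (at \<tau> within {0..})" if "\<tau> \<in> {0..}" for \<tau>
    using deriv[of k \<tau>] galerkin_rhs_eq_0[OF assms(1)] that assms by (cases "k = 0") auto
  then obtain c where "\<And>\<tau>. \<tau> \<in> {0..} \<Longrightarrow> u \<tau> k = c"
    using has_vector_derivative_zero_constant[of "{0..}" "\<lambda>\<tau>. u \<tau> k"] by auto
  then show ?thesis using assms initial[of k] by simp
qed

text \<open>The conjugate reflection of a solution is again a solution with the same initial value, so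
  reality is uniqueness for a locally Lipschitz system.\<close>
lemma reality_freqs:
  assumes k: "k \<in> freqs m" and t: "0 \<le> t"
  shows "u t (- k) = cnj (u t k)"
proof -
  obtain B where B: "0 \<le> B" "\<And>\<tau> k. \<tau> \<in> {0..t} \<Longrightarrow> k \<in> freqs m \<Longrightarrow> cmod (u \<tau> k) \<le> B"
    using bounded_modes by blast
  define w where "w = (\<lambda>\<tau> k. cnj (u \<tau> (- k)))"
  define d where "d = (\<lambda>\<tau> k. u \<tau> k - w \<tau> k)"
  define d' where "d' = (\<lambda>\<tau> k. galerkin_rhs m (u \<tau>) \<tau> k - galerkin_rhs m (w \<tau>) \<tau> k)"
  define D where "D = (\<lambda>\<tau>. \<Sum>k\<in>freqs m. d \<tau> k \<bullet> d \<tau> k)"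
  define D' where "D' = (\<lambda>\<tau>. \<Sum>k\<in>freqs m. d \<tau> k \<bullet> d' \<tau> k + d' \<tau> k \<bullet> d \<tau> k)"
  define A where "A = 2 * real m * B * real (card (freqs m))"
  have wB: "cmod (w \<tau> k) \<le> B" if "\<tau> \<in> {0..t}" "k \<in> freqs m" for \<tau> k
    using B(2)[of \<tau> "- k"] that by (simp add: w_def)
  have dd: "((\<lambda>\<tau>. d \<tau> k) has_vector_derivative d' \<tau> k) (at \<tau> within {0..})" if "k \<in> freqs m" "0 \<le> \<tau>" for k \<tau>
  proof -
    have "((\<lambda>\<tau>. w \<tau> k) has_vector_derivative galerkin_rhs m (w \<tau>) \<tau> k) (at \<tau> within {0..})"
      using has_vector_derivative_cnj[OF deriv_freqs[of "- k" \<tau>]] that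
      unfolding w_def by (simp add: cnj_galerkin_rhs)
    then show ?thesis unfolding d_def d'_def
      using that by (intro has_vector_derivative_diff deriv_freqs)
  qed
  have "(D has_vector_derivative D' \<tau>) (at \<tau> within {0..})" if "0 \<le> \<tau>" for \<tau>
    unfolding D_def D'_def using that
    by (intro has_vector_derivative_sum bounded_bilinear.has_vector_derivative[OF bounded_bilinear_inner] dd)
  moreover have "D' \<tau> \<le> A * D \<tau>" if \<tau>: "0 \<le> \<tau>" "\<tau> \<le> t" for \<tau>
  proof -
    define S where "S = (\<Sum>k\<in>freqs m. cmod (d \<tau> k))"
    have S0: "0 \<le> S" by (auto simp: S_def intro: sum_nonneg)
    have d'S: "cmod (d' \<tau> k) \<le> real m * B * S" if k: "k \<in> freqs m" for k
    proof -
      \<comment> \<open>The difference of the quadratic terms is linear in \<open>d\<close>: write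
        \<open>u u - w w\<close> as \<open>u d + d w\<close>.\<close>
      have "d' \<tau> k = (1/2) * \<i> * of_int k * (\<Sum>j\<in>splits m k. osc j (k - j) (- k) \<tau> * (u \<tau> j * d \<tau> (k - j) + d \<tau> j * w \<tau> (k - j)))"
        using k by (simp add: d'_def galerkin_rhs_eq d_def algebra_simps sum_subtractf sum.distrib sum_distrib_left)
      then have "cmod (d' \<tau> k) = (1/2) * \<bar>of_int k\<bar> * cmod (\<Sum>j\<in>splits m k. osc j (k - j) (- k) \<tau> * (u \<tau> j * d \<tau> (k - j) + d \<tau> j * w \<tau> (k - j)))"
        by (simp only: norm_mult norm_ii norm_of_int) simp
      also have "\<dots> \<le> (1/2) * real m * (\<Sum>j\<in>splits m k. B * cmod (d \<tau> (k - j)) + B * cmod (d \<tau> j))"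
      proof (intro mult_mono)
        show "cmod (\<Sum>j\<in>splits m k. osc j (k - j) (- k) \<tau> * (u \<tau> j * d \<tau> (k - j) + d \<tau> j * w \<tau> (k - j))) \<le> (\<Sum>j\<in>splits m k. B * cmod (d \<tau> (k - j)) + B * cmod (d \<tau> j))"
        proof (intro sum_norm_le)
          fix j assume "j \<in> splits m k"
          then have j: "j \<in> freqs m" "k - j \<in> freqs m" by (auto simp: splits_def)
          have "cmod (u \<tau> j * d \<tau> (k - j) + d \<tau> j * w \<tau> (k - j)) \<le> cmod (u \<tau> j * d \<tau> (k - j)) + cmod (d \<tau> j * w \<tau> (k - j))"
            by (rule norm_triangle_ineq)
          also have "\<dots> \<le> B * cmod (d \<tau> (k - j)) + cmod (d \<tau> j) * B"
            unfolding norm_mult using B wB j \<tau> by (intro add_mono mult_mono) auto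
          finally show "cmod (osc j (k - j) (- k) \<tau> * (u \<tau> j * d \<tau> (k - j) + d \<tau> j * w \<tau> (k - j))) \<le> B * cmod (d \<tau> (k - j)) + B * cmod (d \<tau> j)"
            by (simp add: norm_mult mult.commute)
        qed
      qed (use k in \<open>auto simp: freqs_def\<close>)
      also have "(\<Sum>j\<in>splits m k. B * cmod (d \<tau> (k - j)) + B * cmod (d \<tau> j)) \<le> B * S + B * S"
      proof -
        have "(\<Sum>j\<in>splits m k. cmod (d \<tau> (k - j))) = (\<Sum>j\<in>(\<lambda>j. k - j) ` splits m k. cmod (d \<tau> j))"
          by (subst sum.reindex) (auto simp: inj_on_def)
        also have "\<dots> \<le> S" unfolding S_def by (intro sum_mono2) (auto simp: splits_def)
        finally have 1: "(\<Sum>j\<in>splits m k. cmod (d \<tau> (k - j))) \<le> S" .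
        have 2: "(\<Sum>j\<in>splits m k. cmod (d \<tau> j)) \<le> S"
          unfolding S_def by (intro sum_mono2) (auto simp: splits_def)
        show ?thesis unfolding sum.distrib sum_distrib_left[symmetric]
          using 1 2 B by (intro add_mono mult_left_mono)
      qed
      finally show ?thesis by (simp add: mult_left_mono)
    qed
    have "D' \<tau> = (\<Sum>k\<in>freqs m. 2 * (d \<tau> k \<bullet> d' \<tau> k))"
      unfolding D'_def by (intro sum.cong) (auto simp: inner_commute)
    also have "\<dots> \<le> (\<Sum>k\<in>freqs m. 2 * (cmod (d \<tau> k) * (real m * B * S)))"
    proof (intro sum_mono mult_left_mono)
      fix k assume k: "k \<in> freqs m"
      have "d \<tau> k \<bullet> d' \<tau> k \<le> cmod (d \<tau> k) * cmod (d' \<tau> k)" by (rule norm_cauchy_schwarz)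
      also have "\<dots> \<le> cmod (d \<tau> k) * (real m * B * S)" using d'S[OF k] by (intro mult_left_mono) auto
      finally show "d \<tau> k \<bullet> d' \<tau> k \<le> cmod (d \<tau> k) * (real m * B * S)" .
    qed simp
    also have "\<dots> = 2 * real m * B * S\<^sup>2"
      by (simp add: S_def power2_eq_square mult_ac flip: sum_distrib_left sum_distrib_right)
    also have "\<dots> \<le> 2 * real m * B * (real (card (freqs m)) * D \<tau>)"
    proof (rule mult_left_mono)
      show "S\<^sup>2 \<le> real (card (freqs m)) * D \<tau>"
        using Cauchy_Schwarz_ineq_sum[of "\<lambda>_. 1" "\<lambda>k. cmod (d \<tau> k)" "freqs m"]
        by (simp add: S_def D_def power2_norm_eq_inner)
    qed (use B in auto)
    finally show ?thesis by (simp add: A_def mult_ac)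
  qed
  ultimately have "D t \<le> D 0 * exp (A * t)"
    using t by (rule gronwall) auto
  moreover have "D 0 = 0"
    unfolding D_def by (intro sum.neutral) (auto simp: d_def w_def initial real0 freqs_def)
  ultimately have "D t \<le> 0" by simp
  moreover have "d t (- k) \<bullet> d t (- k) \<le> D t"
    unfolding D_def using k by (intro member_le_sum) auto
  ultimately have "d t (- k) \<bullet> d t (- k) = 0" by (smt (verit) inner_ge_zero)
  then show ?thesis by (simp add: d_def w_def)
qed

lemma reality:
  assumes "k \<noteq> 0" "0 \<le> t"
  shows "u t (- k) = cnj (u t k)"
proof (cases "\<bar>k\<bar> \<le> int m")
  case True
  then show ?thesis using reality_freqs assms by (simp add: freqs_def)
next
  case False
  then show ?thesis using const_mode[of k t] const_mode[of "- k" t] real0 assms by simp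
qed

section \<open>Energy, its cubic correction, and Gronwall's inequality\<close>

definition energy :: "real \<Rightarrow> real \<Rightarrow> real" where
  "energy s t = (\<Sum>k\<in>freqs m. \<bar>of_int k\<bar> powr (2 * s) * (cmod (u t k))\<^sup>2)"

definition correction :: "real \<Rightarrow> real \<Rightarrow> complex" where
  "correction s t = (\<Sum>(a, b, c)\<in>triads m. of_real (triad_coeff s a b c) * (osc a b c t * (u t a * u t b * u t c)))"

text \<open>The time derivative can fall on any of the three modes of the correction; by rotation
  the three contributions agree, hence the 3. The sign is that of a correction subtracted from the
  energy.\<close>

definition remainder :: "real \<Rightarrow> real \<Rightarrow> complex" where
  "remainder s t = - 3 * (\<Sum>(a, b, c)\<in>triads m. of_real (triad_coeff s a b c) *
     (osc a b c t * (u t a * u t b * galerkin_rhs m (u t) t c)))"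

lemma energy_nonneg: "0 \<le> energy s t"
  unfolding energy_def by (intro sum_nonneg) auto

text \<open>The energy is written with \<open>u k * u (- k)\<close>, which can be differentiated by
  the product rule. The two terms agree after reflecting \<open>k\<close>, which cancels the 1/2 of
  the equation; averaging over the three rotations of a triad leaves
  \<open>- \<i> / 3\<close>.\<close>

lemma energy_deriv:
  assumes t: "0 \<le> t"
  shows "((\<lambda>\<tau>. \<Sum>k\<in>freqs m. of_real (\<bar>of_int k\<bar> powr (2 * s)) * (u \<tau> k * u \<tau> (- k))) has_vector_derivative
     (- \<i> / 3) * (\<Sum>(a, b, c)\<in>triads m. of_real (phi s a + phi s b + phi s c) * (osc a b c t * (u t a * u t b * u t c))))
     (at t within {0..})"
proof -
  define w where "w = (\<lambda>k. complex_of_real (\<bar>real_of_int k\<bar> powr (2 * s)))"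
  define r where "r = galerkin_rhs m (u t) t"
  define g where "g = (\<lambda>a b c. osc a b c t * (u t a * u t b * u t c))"
  have g_rot: "g b c a = g a b c" for a b c by (simp add: g_def osc_rotate mult_ac)
  have "((\<lambda>\<tau>. \<Sum>k\<in>freqs m. w k * (u \<tau> k * u \<tau> (- k))) has_vector_derivative
     (\<Sum>k\<in>freqs m. w k * (u t k * r (- k) + r k * u t (- k)))) (at t within {0..})"
    unfolding r_def using t
    by (intro has_vector_derivative_sum has_vector_derivative_mult_right has_vector_derivative_mult deriv_freqs) auto
  also have "(\<Sum>k\<in>freqs m. w k * (u t k * r (- k) + r k * u t (- k))) =
      (\<Sum>k\<in>freqs m. w k * (u t k * r (- k))) + (\<Sum>k\<in>freqs m. w k * (r k * u t (- k)))"
    by (simp add: algebra_simps sum.distrib)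
  also have "(\<Sum>k\<in>freqs m. w k * (u t k * r (- k))) = (\<Sum>k\<in>freqs m. w k * (r k * u t (- k)))"
    by (rule sum.reindex_bij_witness[of _ uminus uminus]) (auto simp: w_def mult.commute)
  also have "(\<Sum>k\<in>freqs m. w k * (r k * u t (- k))) =
      (\<Sum>k\<in>freqs m. \<Sum>d\<in>splits m k. - \<i> / 2 * of_real (phi s (- k)) * g d (k - d) (- k))"
    unfolding r_def
    by (intro sum.cong refl)
      (simp add: galerkin_rhs_eq g_def w_def phi_def sum_distrib_left sum_distrib_right mult_ac)
  also have "\<dots> = (\<Sum>(a, b, c)\<in>triads m. - \<i> / 2 * of_real (phi s c) * g a b c)"
    by (rule sum_splits_triads)
  also have "\<dots> = - \<i> / 2 * (\<Sum>(a, b, c)\<in>triads m. of_real (phi s c) * g a b c)"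
    by (simp add: sum_distrib_left split_beta mult_ac)
  also have "(\<Sum>(a, b, c)\<in>triads m. of_real (phi s c) * g a b c) =
      (\<Sum>(a, b, c)\<in>triads m. of_real (phi s a + phi s b + phi s c) * g a b c) / 3"
  proof -
    have 1: "(\<Sum>(a, b, c)\<in>triads m. of_real (phi s c) * g a b c) = (\<Sum>(a, b, c)\<in>triads m. of_real (phi s a) * g a b c)"
      using triads_rotate[of "\<lambda>a b c. of_real (phi s c) * g a b c" m] by (simp add: g_rot)
    have 2: "(\<Sum>(a, b, c)\<in>triads m. of_real (phi s a) * g a b c) = (\<Sum>(a, b, c)\<in>triads m. of_real (phi s b) * g a b c)"
      using triads_rotate[of "\<lambda>a b c. of_real (phi s a) * g a b c" m] by (simp add: g_rot)
    have "(\<Sum>(a, b, c)\<in>triads m. of_real (phi s a + phi s b + phi s c) * g a b c) =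
      (\<Sum>(a, b, c)\<in>triads m. of_real (phi s a) * g a b c) + (\<Sum>(a, b, c)\<in>triads m. of_real (phi s b) * g a b c)
      + (\<Sum>(a, b, c)\<in>triads m. of_real (phi s c) * g a b c)"
      by (simp add: split_beta algebra_simps sum.distrib)
    then show ?thesis using 1 2 by simp
  qed
  finally show ?thesis by (simp add: w_def g_def)
qed

text \<open>Differentiating the phase reproduces the derivative of the energy, because
  \<open>triad_coeff\<close> was divided by the phase frequency. Differentiating the modes gives
  three sums equal by rotation, which are minus the remainder.\<close>

lemma correction_deriv:
  assumes t: "0 \<le> t"
  shows "(correction s has_vector_derivative
     (- \<i> / 3) * (\<Sum>(a, b, c)\<in>triads m. of_real (phi s a + phi s b + phi s c) * (osc a b c t * (u t a * u t b * u t c)))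
       - remainder s t) (at t within {0..})"
proof -
  define r where "r = galerkin_rhs m (u t) t"
  define h where "h = (\<lambda>a b c. of_real (triad_coeff s a b c) * (osc a b c t * (u t a * u t b * r c)))"
  define h' where "h' = (\<lambda>(a, b, c). of_real (triad_coeff s a b c) *
     (osc a b c t * ((u t a * u t b) * r c + (u t a * r b + r a * u t b) * u t c)
      + osc a b c t * (- 3 * \<i> * of_int (a * b * c)) * (u t a * u t b * u t c)))"
  have "(correction s has_vector_derivative (\<Sum>q\<in>triads m. h' q)) (at t within {0..})"
    unfolding correction_def h'_def r_def
  proof (intro has_vector_derivative_sum)
    fix q assume "q \<in> triads m"
    then obtain a b c where q: "q = (a, b, c)" "a \<in> freqs m" "b \<in> freqs m" "c \<in> freqs m" by (auto simp: triads_def)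
    show "((\<lambda>\<tau>. case q of (a, b, c) \<Rightarrow> of_real (triad_coeff s a b c) * (osc a b c \<tau> * (u \<tau> a * u \<tau> b * u \<tau> c)))
      has_vector_derivative (case q of (a, b, c) \<Rightarrow> of_real (triad_coeff s a b c) *
     (osc a b c t * ((u t a * u t b) * galerkin_rhs m (u t) t c + (u t a * galerkin_rhs m (u t) t b + galerkin_rhs m (u t) t a * u t b) * u t c)
      + osc a b c t * (- 3 * \<i> * of_int (a * b * c)) * (u t a * u t b * u t c)))) (at t within {0..})"
      unfolding q(1) prod.case using q t
      by (intro has_vector_derivative_mult_right has_vector_derivative_mult deriv_freqs osc_has_vector_derivative)
  qed
  also have "(\<Sum>q\<in>triads m. h' q) = (\<Sum>(a, b, c)\<in>triads m. (- \<i> / 3) * (of_real (phi s a + phi s b + phi s c) * (osc a b c t * (u t a * u t b * u t c)))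
      + (h a b c + h b c a + h c a b))"
  proof (intro sum.cong refl)
    fix q assume "q \<in> triads m"
    then obtain a b c where q: "q = (a, b, c)" "a \<noteq> 0" "b \<noteq> 0" "c \<noteq> 0" by (auto simp: triads_def freqs_def)
    have co: "triad_coeff s b c a = triad_coeff s a b c" "triad_coeff s c a b = triad_coeff s a b c"
      using triad_coeff_rotate by metis+
    have os: "osc b c a t = osc a b c t" "osc c a b t = osc a b c t"
      using osc_rotate by metis+
    have ph: "complex_of_real (triad_coeff s a b c) * (- 3 * \<i> * of_int (a * b * c)) = (- \<i> / 3) * of_real (phi s a + phi s b + phi s c)"
      using q by (simp add: triad_coeff_def field_simps)
    have "h' q = (complex_of_real (triad_coeff s a b c) * (- 3 * \<i> * of_int (a * b * c))) * (osc a b c t * (u t a * u t b * u t c)) + (h a b c + h b c a + h c a b)"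
      by (simp add: q h'_def h_def co os algebra_simps)
    then show "h' q = (case q of (a, b, c) \<Rightarrow> (- \<i> / 3) * (of_real (phi s a + phi s b + phi s c) * (osc a b c t * (u t a * u t b * u t c)))
      + (h a b c + h b c a + h c a b))"
      unfolding ph by (simp add: q)
  qed
  also have "\<dots> = (- \<i> / 3) * (\<Sum>(a, b, c)\<in>triads m. of_real (phi s a + phi s b + phi s c) * (osc a b c t * (u t a * u t b * u t c)))
       + ((\<Sum>(a, b, c)\<in>triads m. h a b c) + (\<Sum>(a, b, c)\<in>triads m. h b c a) + (\<Sum>(a, b, c)\<in>triads m. h c a b))"
    by (simp only: case_prod_unfold sum.distrib sum_distrib_left)
  also have "(\<Sum>(a, b, c)\<in>triads m. h c a b) = (\<Sum>(a, b, c)\<in>triads m. h a b c)"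
    by (rule triads_rotate)
  also have "(\<Sum>(a, b, c)\<in>triads m. h b c a) = (\<Sum>(a, b, c)\<in>triads m. h a b c)"
    by (rule triads_rotate[symmetric])
  finally show ?thesis by (simp add: remainder_def h_def r_def)
qed

definition modified_energy :: "real \<Rightarrow> real \<Rightarrow> real" where
  "modified_energy s t = energy s t - Re (correction s t)"

text \<open>The triad sums of the two preceding derivatives cancel. Reality enters only to identify
  the differentiated polynomial with the energy defined by moduli.\<close>

lemma modified_energy_deriv:
  assumes t: "0 \<le> t"
  shows "(modified_energy s has_vector_derivative Re (remainder s t)) (at t within {0..})"
proof -
  define F where "F = (\<lambda>\<tau>. (\<Sum>k\<in>freqs m. of_real (\<bar>of_int k\<bar> powr (2 * s)) * (u \<tau> k * u \<tau> (- k))) - correction s \<tau>)"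
  have "(F has_vector_derivative remainder s t) (at t within {0..})"
    using has_vector_derivative_diff[OF energy_deriv[OF t, of s] correction_deriv[OF t, of s]] by (simp add: F_def)
  then have "((\<lambda>\<tau>. Re (F \<tau>)) has_vector_derivative Re (remainder s t)) (at t within {0..})"
    by (rule bounded_linear.has_vector_derivative[OF bounded_linear_Re])
  moreover have "Re (F \<tau>) = modified_energy s \<tau>" if "0 \<le> \<tau>" for \<tau>
  proof -
    have "Re (of_real (\<bar>of_int k\<bar> powr (2 * s)) * (u \<tau> k * u \<tau> (- k))) = \<bar>of_int k\<bar> powr (2 * s) * (cmod (u \<tau> k))\<^sup>2"
      if "k \<in> freqs m" for k
      using that \<open>0 \<le> \<tau>\<close> by (simp add: reality_freqs complex_mult_cnj cmod_power2)
    then show ?thesis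
      by (simp only: F_def modified_energy_def energy_def minus_complex.sel Re_sum cong: sum.cong)
  qed
  ultimately show ?thesis
    using t by (elim has_vector_derivative_transform[rotated 2]) auto
qed

text \<open>At \<open>s = 0\<close> the function \<open>phi\<close> is the identity on nonzero
  frequencies, so the numerator is \<open>a + b + c = 0\<close>.\<close>

lemma triad_coeff_0: "(a, b, c) \<in> triads m \<Longrightarrow> triad_coeff 0 a b c = 0"
  by (auto simp: triads_def freqs_def triad_coeff_def phi_def simp flip: of_int_add)

lemma energy_0_conserved:
  assumes t: "0 \<le> t"
  shows "energy 0 t = energy 0 0"
proof -
  have C: "correction 0 \<tau> = 0" for \<tau>
    unfolding correction_def using triad_coeff_0 by (intro sum.neutral) auto
  have R: "remainder 0 \<tau> = 0" for \<tau>
    using triad_coeff_0 by (auto simp: remainder_def intro!: sum.neutral)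
  have "modified_energy 0 = energy 0"
    by (rule ext) (simp add: modified_energy_def C)
  then have "(energy 0 has_vector_derivative 0) (at \<tau> within {0..})" if "\<tau> \<in> {0..}" for \<tau>
    using modified_energy_deriv[of \<tau> 0] that by (simp add: R)
  then obtain c where "\<And>\<tau>. \<tau> \<in> {0..} \<Longrightarrow> energy 0 \<tau> = c"
    using has_vector_derivative_zero_constant[of "{0..}" "energy 0"] by auto
  then show ?thesis using t by simp
qed

lemma energy_0: "energy 0 t = (\<Sum>k\<in>freqs m. (cmod (u t k))\<^sup>2)"
  unfolding energy_def by (intro sum.cong) (auto simp: freqs_def)

text \<open>The constant is \<open>3 * (1/2) * 192\<close>: 3 from the definition of the remainder,
  1/2 from the right-hand side of the system. Conservation of mass then replaces the mass at time
  \<open>t\<close> by the initial one.\<close>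

lemma remainder_le:
  assumes s: "0 \<le> s" and t: "0 \<le> t"
  shows "\<bar>Re (remainder s t)\<bar> \<le> 288 * ((2 * s + 2) * 4 powr s * 9 powr s) * energy 0 0 * energy s t"
proof -
  define x where "x = (\<lambda>k. cmod (u t k))"
  have "\<bar>Re (remainder s t)\<bar> \<le> cmod (remainder s t)" by (rule abs_Re_le_cmod)
  also have "\<dots> \<le> 3 * (\<Sum>(a, b, c)\<in>triads m. \<bar>triad_coeff s a b c\<bar> * (x a * x b * cmod (galerkin_rhs m (u t) t c)))"
    unfolding remainder_def norm_mult
    by (auto simp: norm_mult x_def intro!: mult_left_mono sum_norm_le)
  also have "\<dots> \<le> 3 * (\<Sum>(a, b, c)\<in>triads m. 1/2 * (\<bar>triad_coeff s a b c\<bar> * \<bar>of_int c\<bar> * (x a * x b * (\<Sum>d\<in>splits m c. x d * x (c - d)))))"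
  proof (intro mult_left_mono sum_mono)
    fix q assume "q \<in> triads m"
    then obtain a b c where q: "q = (a, b, c)" "c \<in> freqs m" by (auto simp: triads_def)
    have "cmod (galerkin_rhs m (u t) t c) = 1/2 * \<bar>of_int c\<bar> * cmod (\<Sum>d\<in>splits m c. osc d (c - d) (- c) t * u t d * u t (c - d))"
      using q(2) by (simp add: galerkin_rhs_eq norm_mult)
    also have "\<dots> \<le> 1/2 * \<bar>of_int c\<bar> * (\<Sum>d\<in>splits m c. x d * x (c - d))"
      by (intro mult_left_mono sum_norm_le) (auto simp: norm_mult x_def)
    finally have "\<bar>triad_coeff s a b c\<bar> * (x a * x b * cmod (galerkin_rhs m (u t) t c))
       \<le> \<bar>triad_coeff s a b c\<bar> * (x a * x b * (1/2 * \<bar>of_int c\<bar> * (\<Sum>d\<in>splits m c. x d * x (c - d))))"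
      by (intro mult_left_mono) (auto simp: x_def)
    then show "(case q of (a, b, c) \<Rightarrow> \<bar>triad_coeff s a b c\<bar> * (x a * x b * cmod (galerkin_rhs m (u t) t c)))
       \<le> (case q of (a, b, c) \<Rightarrow> 1/2 * (\<bar>triad_coeff s a b c\<bar> * \<bar>of_int c\<bar> * (x a * x b * (\<Sum>d\<in>splits m c. x d * x (c - d)))))"
      by (simp add: q mult_ac)
  qed simp
  also have "\<dots> = 3/2 * (\<Sum>(a, b, c)\<in>triads m. \<bar>triad_coeff s a b c\<bar> * \<bar>of_int c\<bar> * (x a * x b * (\<Sum>d\<in>splits m c. x d * x (c - d))))"
    by (simp add: split_beta flip: sum_divide_distrib)
  also have "\<dots> \<le> 3/2 * (192 * ((2 * s + 2) * 4 powr s * 9 powr s) * (\<Sum>k\<in>freqs m. (x k)\<^sup>2)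
       * (\<Sum>k\<in>freqs m. \<bar>of_int k\<bar> powr (2 * s) * (x k)\<^sup>2))"
    by (intro mult_left_mono quartic_le s) (auto simp: x_def)
  also have "\<dots> = 288 * ((2 * s + 2) * 4 powr s * 9 powr s) * energy 0 t * energy s t"
    by (simp add: energy_0 x_def energy_def[of s])
  finally show ?thesis using energy_0_conserved[OF t] by simp
qed

lemma correction_le:
  assumes s: "0 \<le> s" and t: "0 \<le> t" and R: "0 < R"
  shows "\<bar>Re (correction s t)\<bar> \<le>
    6 * ((2 * s + 2) * 4 powr s) * (energy s t / R + R powr (2 * s) * energy 0 0) * sqrt (energy 0 0)"
proof -
  define x where "x = (\<lambda>k. cmod (u t k))"
  have "\<bar>Re (correction s t)\<bar> \<le> cmod (correction s t)" by (rule abs_Re_le_cmod)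
  also have "\<dots> \<le> (\<Sum>(a, b, c)\<in>triads m. \<bar>triad_coeff s a b c\<bar> * (x a * x b * x c))"
    unfolding correction_def by (auto simp: norm_mult x_def intro!: sum_norm_le)
  also have "\<dots> \<le> 6 * ((2 * s + 2) * 4 powr s) * (energy s t / R + R powr (2 * s) * energy 0 t) * sqrt (energy 0 t)"
    using cubic_le[OF s R, of m x] by (simp add: energy_def[of s] energy_0 x_def)
  finally show ?thesis using energy_0_conserved[OF t] by simp
qed

end

text \<open>Arguments \<open>L\<close> and \<open>e\<close> are bounds for the squared mass norm and
  the initial energy. \<open>R\<close> makes \<open>K * sqrt L / R\<close> at most 1/2, and
  \<open>P\<close> is the low-frequency cost of the correction. In the exponent,
  \<open>576 = 2 * 288\<close>, since the energy is at most twice the quantity to which Gronwall is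
  applied.\<close>

definition apriori_bound :: "real \<Rightarrow> real \<Rightarrow> real \<Rightarrow> real \<Rightarrow> real" where
  "apriori_bound s T L e =
    (let K = 6 * ((2 * s + 2) * 4 powr s); R = 2 * K * sqrt L + 1; P = K * R powr (2 * s) * L * sqrt L
     in (3 * e + 4 * P) * exp (576 * ((2 * s + 2) * 4 powr s * 9 powr s) * L * T))"

lemma (in galerkin) energy_le:
  assumes s: "0 \<le> s" and t: "0 \<le> t" "t \<le> T" and L: "energy 0 0 \<le> L" and e: "energy s 0 \<le> e"
  shows "energy s t \<le> apriori_bound s T L e"
proof -
  define K where "K = 6 * ((2 * s + 2) * 4 powr s)"
  define R where "R = 2 * K * sqrt L + 1"
  define P where "P = K * R powr (2 * s) * L * sqrt L"
  define G where "G = 288 * ((2 * s + 2) * 4 powr s * 9 powr s) * L"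
  have L0: "0 \<le> L" using L energy_nonneg[of 0 0] by linarith
  have K: "0 \<le> K" using s by (simp add: K_def)
  have R: "1 \<le> R" using K L0 by (simp add: R_def)
  have P: "0 \<le> P" using K L0 by (simp add: P_def)
  have G: "0 \<le> G" using s L0 by (simp add: G_def)
  have cor: "\<bar>Re (correction s \<tau>)\<bar> \<le> energy s \<tau> / 2 + P" if "0 \<le> \<tau>" for \<tau>
  proof -
    have "\<bar>Re (correction s \<tau>)\<bar> \<le> K * (energy s \<tau> / R + R powr (2 * s) * energy 0 0) * sqrt (energy 0 0)"
      unfolding K_def using s that R by (intro correction_le) auto
    also have "\<dots> \<le> K * (energy s \<tau> / R + R powr (2 * s) * L) * sqrt L"
      using K R L energy_nonneg[of s \<tau>] energy_nonneg[of 0 0]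
      by (intro mult_mono add_mono) (auto intro!: add_nonneg_nonneg mult_nonneg_nonneg divide_nonneg_nonneg)
    also have "\<dots> = (K * sqrt L) / R * energy s \<tau> + P" by (simp add: P_def field_simps)
    also have "(K * sqrt L) / R \<le> 1 / 2"
      using R by (simp add: divide_simps) (simp add: R_def)
    finally show ?thesis using energy_nonneg[of s \<tau>] by (simp add: mult_right_mono)
  qed
  \<comment> \<open>Adding \<open>P\<close> makes the modified energy dominate half the energy, so
    the remainder is bounded by a multiple of \<open>Z\<close> itself and Gronwall closes.\<close>
  define Z where "Z = (\<lambda>\<tau>. modified_energy s \<tau> + P)"
  have EZ: "energy s \<tau> \<le> 2 * Z \<tau>" if "0 \<le> \<tau>" for \<tau>
    using cor[OF that] by (simp add: Z_def modified_energy_def)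
  have "Z t \<le> Z 0 * exp (2 * G * t)"
  proof (rule gronwall[of Z "\<lambda>\<tau>. Re (remainder s \<tau>)" t])
    show "(Z has_vector_derivative Re (remainder s \<tau>)) (at \<tau> within {0..})" if "0 \<le> \<tau>" for \<tau>
      using has_vector_derivative_add[OF modified_energy_deriv[OF that] has_vector_derivative_const] by (simp add: Z_def)
    show "Re (remainder s \<tau>) \<le> 2 * G * Z \<tau>" if "0 \<le> \<tau>" for \<tau>
    proof -
      have "Re (remainder s \<tau>) \<le> 288 * ((2 * s + 2) * 4 powr s * 9 powr s) * energy 0 0 * energy s \<tau>"
        using remainder_le[OF s that] by linarith
      also have "\<dots> \<le> G * energy s \<tau>"
        unfolding G_def using L s energy_nonneg[of s \<tau>] by (intro mult_right_mono mult_left_mono) auto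
      also have "\<dots> \<le> G * (2 * Z \<tau>)" using EZ[OF that] G by (intro mult_left_mono)
      finally show ?thesis by simp
    qed
  qed (use t in auto)
  also have "\<dots> \<le> (3 / 2 * e + 2 * P) * exp (2 * G * T)"
  proof (intro mult_mono)
    show "Z 0 \<le> 3 / 2 * e + 2 * P" using cor[of 0] e by (simp add: Z_def modified_energy_def)
    show "exp (2 * G * t) \<le> exp (2 * G * T)" using G t by (simp add: mult_left_mono)
    show "0 \<le> 3 / 2 * e + 2 * P" using e energy_nonneg[of s 0] P by linarith
  qed auto
  finally have "energy s t \<le> 2 * ((3 / 2 * e + 2 * P) * exp (2 * G * T))"
    using EZ[OF t(1)] by linarith
  then show ?thesis
    by (simp add: apriori_bound_def Let_def K_def[symmetric] R_def[symmetric] P_def[symmetric]) (simp add: G_def algebra_simps)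
qed

section \<open>Passage to the limit\<close>

text \<open>A tail bound on finite sets passes to the pointwise limit, so \<open>a j\<close> and
  \<open>b\<close> are absolutely summable with the same small tails outside \<open>F\<close>; on
  the finite set \<open>F\<close> convergence is termwise. This single lemma serves the strong norm,
  the mass, the pairing and the nonlinearity.\<close>

lemma infsum_tendsto_uniform_tails:
  fixes a :: "nat \<Rightarrow> 'k \<Rightarrow> 'b::banach"
  assumes conv: "\<And>k. k \<in> A \<Longrightarrow> (\<lambda>j. a j k) \<longlonglongrightarrow> b k"
    and tails: "\<And>\<epsilon>. 0 < \<epsilon> \<Longrightarrow> \<exists>F. finite F \<and> F \<subseteq> A \<and>
      (\<forall>j G. finite G \<longrightarrow> G \<subseteq> A - F \<longrightarrow> (\<Sum>k\<in>G. norm (a j k)) \<le> \<epsilon>)"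
  shows "(\<lambda>k. norm (b k)) summable_on A" and "(\<lambda>j. infsum (a j) A) \<longlonglongrightarrow> infsum b A"
proof -
  have tails_b: "(\<Sum>k\<in>G. norm (b k)) \<le> \<epsilon>"
    if F: "\<And>j. (\<Sum>k\<in>G. norm (a j k)) \<le> \<epsilon>" "G \<subseteq> A" for G \<epsilon>
  proof (rule LIMSEQ_le_const2)
    show "(\<lambda>j. \<Sum>k\<in>G. norm (a j k)) \<longlonglongrightarrow> (\<Sum>k\<in>G. norm (b k))"
      using that conv by (intro tendsto_sum tendsto_norm) auto
  qed (use F in auto)
  have summable: "(\<lambda>k. norm (c k)) summable_on A"
    if "finite F" "F \<subseteq> A" "\<And>G. finite G \<Longrightarrow> G \<subseteq> A - F \<Longrightarrow> (\<Sum>k\<in>G. norm (c k)) \<le> \<epsilon>" for c :: "'k \<Rightarrow> 'b" and F \<epsilon>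
  proof (rule nonneg_bdd_above_summable_on)
    show "bdd_above (sum (\<lambda>k. norm (c k)) ` {G. G \<subseteq> A \<and> finite G})"
    proof (rule bdd_aboveI2)
      fix G assume G: "G \<in> {G. G \<subseteq> A \<and> finite G}"
      have "(\<Sum>k\<in>G. norm (c k)) = (\<Sum>k\<in>G \<inter> F. norm (c k)) + (\<Sum>k\<in>G - F. norm (c k))"
        using G by (intro sum.Int_Diff) auto
      also have "\<dots> \<le> (\<Sum>k\<in>F. norm (c k)) + \<epsilon>"
        using G that(1,2) that(3)[of "G - F"] by (intro add_mono sum_mono2) auto
      finally show "(\<Sum>k\<in>G. norm (c k)) \<le> (\<Sum>k\<in>F. norm (c k)) + \<epsilon>" .
    qed
  qed auto
  have rest: "norm (infsum c A - sum c F) \<le> \<epsilon>"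
    if F: "finite F" "F \<subseteq> A" "\<And>G. finite G \<Longrightarrow> G \<subseteq> A - F \<Longrightarrow> (\<Sum>k\<in>G. norm (c k)) \<le> \<epsilon>" for c :: "'k \<Rightarrow> 'b" and F \<epsilon>
  proof -
    have sn: "(\<lambda>k. norm (c k)) summable_on A" by (rule summable[OF F])
    have sn': "(\<lambda>k. norm (c k)) summable_on (A - F)"
      by (rule summable_on_subset_banach[OF sn]) auto
    have "infsum c (F \<union> (A - F)) = infsum c F + infsum c (A - F)"
      using F by (intro infsum_Un_disjoint[OF _ abs_summable_summable[OF sn']]) auto
    moreover have "F \<union> (A - F) = A" using F by auto
    ultimately have "infsum c A - sum c F = infsum c (A - F)" using F by simp
    moreover have "norm (infsum c (A - F)) \<le> infsum (\<lambda>k. norm (c k)) (A - F)"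
      by (rule norm_infsum_bound) (rule sn')
    moreover have "infsum (\<lambda>k. norm (c k)) (A - F) \<le> \<epsilon>"
      by (rule infsum_le_finite_sums[OF sn']) (use F in auto)
    ultimately show ?thesis by simp
  qed
  obtain F where F: "finite F" "F \<subseteq> A" "\<And>j G. finite G \<Longrightarrow> G \<subseteq> A - F \<Longrightarrow> (\<Sum>k\<in>G. norm (a j k)) \<le> 1"
    using tails[of 1] by auto
  show "(\<lambda>k. norm (b k)) summable_on A"
    by (rule summable[OF F(1,2), where \<epsilon> = 1]) (intro tails_b F, auto)
  show "(\<lambda>j. infsum (a j) A) \<longlonglongrightarrow> infsum b A"
  proof (rule LIMSEQ_I)
    fix e :: real assume "0 < e"
    then obtain F where F: "finite F" "F \<subseteq> A" "\<And>j G. finite G \<Longrightarrow> G \<subseteq> A - F \<Longrightarrow> (\<Sum>k\<in>G. norm (a j k)) \<le> e / 4"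
      using tails[of "e / 4"] by auto
    have b: "norm (infsum b A - sum b F) \<le> e / 4"
      by (rule rest[OF F(1,2)]) (intro tails_b F, auto)
    have a: "norm (infsum (a j) A - sum (a j) F) \<le> e / 4" for j
      by (rule rest[OF F(1,2)]) (rule F(3))
    have "(\<lambda>j. sum (a j) F) \<longlonglongrightarrow> sum b F" using F conv by (intro tendsto_sum) auto
    then obtain N where N: "\<And>j. N \<le> j \<Longrightarrow> norm (sum (a j) F - sum b F) < e / 4"
      using LIMSEQ_D[of _ _ "e / 4"] \<open>0 < e\<close> by (meson zero_less_divide_iff zero_less_numeral)
    have "norm (infsum (a j) A - infsum b A) < e" if "N \<le> j" for j
    proof -
      define x y z where "x = infsum (a j) A - sum (a j) F" and "y = sum (a j) F - sum b F"
        and "z = infsum b A - sum b F"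
      have "infsum (a j) A - infsum b A = x + (y - z)" by (simp add: x_def y_def z_def)
      then have "norm (infsum (a j) A - infsum b A) \<le> norm x + (norm y + norm z)"
        using norm_triangle_ineq[of x "y - z"] norm_triangle_ineq4[of y z] by simp
      then show ?thesis using a[of j] b N[OF that] \<open>0 < e\<close> unfolding x_def y_def z_def by linarith
    qed
    then show "\<exists>N. \<forall>j\<ge>N. norm (infsum (a j) A - infsum b A) < e" by blast
  qed
qed

text \<open>The sum is a Bochner integral over counting measure, measurable in the parameter by
  Fubini-type results. Assumption \<open>abs\<close> makes the two notions agree also where the sum
  diverges: both are then 0.\<close>

lemma borel_measurable_infsum:
  fixes f :: "'k \<Rightarrow> 't \<Rightarrow> 'b::{banach, second_countable_topology}"
  assumes A: "countable A" and f: "\<And>k. k \<in> A \<Longrightarrow> f k \<in> borel_measurable M"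
    and abs: "\<And>t. (\<lambda>k. f k t) summable_on A \<longleftrightarrow> (\<lambda>k. norm (f k t)) summable_on A"
  shows "(\<lambda>t. infsum (\<lambda>k. f k t) A) \<in> borel_measurable M"
proof -
  interpret sigma_finite_measure "count_space A"
    using A by (rule sigma_finite_measure_count_space_countable)
  have "(\<lambda>(k, t). f k t) \<in> borel_measurable (count_space A \<Otimes>\<^sub>M M)"
    using A f by (intro measurable_pair_measure_countable1) auto
  then have "(\<lambda>(t, k). f k t) \<in> borel_measurable (M \<Otimes>\<^sub>M count_space A)"
    by (subst measurable_pair_swap_iff) (simp add: split_beta)
  then have "(\<lambda>t. \<integral>k. f k t \<partial>count_space A) \<in> borel_measurable M"
    by (intro borel_measurable_lebesgue_integral) simp
  moreover have "(\<integral>k. f k t \<partial>count_space A) = infsum (\<lambda>k. f k t) A" for t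
  proof (cases "(\<lambda>k. norm (f k t)) summable_on A")
    case True
    then have "Infinite_Set_Sum.abs_summable_on (\<lambda>k. f k t) A"
      by (simp add: abs_summable_equivalent)
    then have "infsetsum (\<lambda>k. f k t) A = infsum (\<lambda>k. f k t) A" by (rule infsetsum_infsum)
    then show ?thesis by (simp add: infsetsum_def)
  next
    case False
    then have "\<not> Infinite_Set_Sum.abs_summable_on (\<lambda>k. f k t) A"
      by (simp add: abs_summable_equivalent)
    then have "(\<integral>k. f k t \<partial>count_space A) = 0"
      by (simp add: Infinite_Set_Sum.abs_summable_on_def not_integrable_integral_eq)
    then show ?thesis using False abs by (simp add: infsum_not_exists)
  qed
  ultimately show ?thesis by simp
qed

section \<open>Sobolev norms, the duality pairing and convolutions\<close>

lemma hs_weight_nonneg [simp]: "0 \<le> hs_weight s v k"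
  by (simp add: hs_weight_def)

lemma hs_weight_0: "k \<noteq> 0 \<Longrightarrow> hs_weight 0 v k = (cmod (v k))\<^sup>2"
  by (simp add: hs_weight_def)

lemma hs_norm_nonneg [simp]: "0 \<le> hs_norm s v"
  by (simp add: hs_norm_def infsum_nonneg)

lemma hs_norm_squared: "(hs_norm s v)\<^sup>2 = (\<Sum>\<^sub>\<infinity>k\<in>Z0. hs_weight s v k)"
  by (simp add: hs_norm_def infsum_nonneg)

lemma sum_hs_weight_le:
  assumes "in_hs s v" "finite G" "G \<subseteq> Z0"
  shows "(\<Sum>k\<in>G. hs_weight s v k) \<le> (hs_norm s v)\<^sup>2"
  unfolding hs_norm_squared using assms by (intro finite_sum_le_infsum) (auto simp: in_hs_def)

lemma in_hsI:
  assumes "\<And>G. finite G \<Longrightarrow> G \<subseteq> Z0 \<Longrightarrow> (\<Sum>k\<in>G. hs_weight s v k) \<le> B"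
  shows "in_hs s v" and "(hs_norm s v)\<^sup>2 \<le> B"
proof -
  show "in_hs s v"
    unfolding in_hs_def using assms by (intro nonneg_bdd_above_summable_on bdd_aboveI2[of _ _ B]) auto
  then show "(hs_norm s v)\<^sup>2 \<le> B"
    unfolding hs_norm_squared in_hs_def using assms by (intro infsum_le_finite_sums) auto
qed

lemma hs_weight_le_high:
  assumes "\<sigma> \<le> s" "0 < N" "real N \<le> \<bar>of_int k\<bar>"
  shows "hs_weight \<sigma> v k \<le> real N powr (2 * (\<sigma> - s)) * hs_weight s v k"
proof -
  have "\<bar>of_int k\<bar> powr (2 * \<sigma>) = \<bar>of_int k\<bar> powr (2 * (\<sigma> - s)) * \<bar>of_int k\<bar> powr (2 * s)"
    by (simp flip: powr_add add: algebra_simps)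
  also have "\<dots> \<le> real N powr (2 * (\<sigma> - s)) * \<bar>of_int k\<bar> powr (2 * s)"
    using assms by (intro mult_right_mono powr_mono2') auto
  finally show ?thesis
    unfolding hs_weight_def mult.assoc[symmetric] by (intro mult_right_mono) auto
qed

lemma hs_weight_mono: "\<sigma> \<le> s \<Longrightarrow> k \<noteq> 0 \<Longrightarrow> hs_weight \<sigma> v k \<le> hs_weight s v k"
  using hs_weight_le_high[of \<sigma> s 1 k v] by simp

lemma in_hs_mono:
  assumes "\<sigma> \<le> s" "in_hs s v"
  shows "in_hs \<sigma> v"
  using assms unfolding in_hs_def
  by (elim summable_on_comparison_test) (auto simp: Z0_def intro: hs_weight_mono)

lemma hs_weight_diff_le: "hs_weight s (\<lambda>k. v k - w k) k \<le> 2 * hs_weight s v k + 2 * hs_weight s w k"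
proof -
  have "(cmod (v k - w k))\<^sup>2 \<le> (cmod (v k) + cmod (w k))\<^sup>2"
    by (intro power_mono norm_triangle_ineq4) auto
  also have "\<dots> \<le> 2 * (cmod (v k))\<^sup>2 + 2 * (cmod (w k))\<^sup>2"
    using sum_squares_bound[of "cmod (v k)" "cmod (w k)"] by (simp add: power2_sum)
  finally have "\<bar>of_int k\<bar> powr (2 * s) * (cmod (v k - w k))\<^sup>2 \<le> \<bar>of_int k\<bar> powr (2 * s) * (2 * (cmod (v k))\<^sup>2 + 2 * (cmod (w k))\<^sup>2)"
    by (intro mult_left_mono) auto
  then show ?thesis by (simp add: hs_weight_def algebra_simps)
qed

lemma sum_mult_le_sqrt:
  fixes f g :: "'k \<Rightarrow> real"
  shows "(\<Sum>k\<in>G. f k * g k) \<le> sqrt (\<Sum>k\<in>G. (f k)\<^sup>2) * sqrt (\<Sum>k\<in>G. (g k)\<^sup>2)"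
  using Cauchy_Schwarz_ineq_sum[of f g G] by (simp add: real_le_rsqrt flip: real_sqrt_mult)

lemma freqs_subset_Z0: "freqs m \<subseteq> Z0"
  by (auto simp: freqs_def Z0_def)

lemma borel_measurable_hs_norm:
  assumes "\<And>k. k \<noteq> 0 \<Longrightarrow> (\<lambda>t. w t k) \<in> borel_measurable M"
  shows "(\<lambda>t. hs_norm s (w t)) \<in> borel_measurable M"
proof -
  have "(\<lambda>t. \<Sum>\<^sub>\<infinity>k\<in>Z0. hs_weight s (w t) k) \<in> borel_measurable M"
    using assms by (intro borel_measurable_infsum) (auto simp: Z0_def hs_weight_def)
  then show ?thesis unfolding hs_norm_def by simp
qed

lemma borel_measurable_pairing:
  assumes "\<And>k. k \<noteq> 0 \<Longrightarrow> (\<lambda>t. w t k) \<in> borel_measurable M" "\<And>k. k \<noteq> 0 \<Longrightarrow> (\<lambda>t. g t k) \<in> borel_measurable M"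
  shows "(\<lambda>t. pairing (w t) (g t)) \<in> borel_measurable M"
proof -
  have "(\<lambda>t. cnj (g t k)) \<in> borel_measurable M" if "k \<noteq> 0" for k
    by (rule borel_measurable_continuous_on[OF _ assms(2)[OF that]]) (intro continuous_intros)
  then show ?thesis
    unfolding pairing_def using assms(1)
    by (intro borel_measurable_infsum) (auto simp: Z0_def summable_on_iff_abs_summable_on_complex)
qed

lemma sum_pairing_le:
  assumes "G \<subseteq> Z0"
  shows "(\<Sum>k\<in>G. cmod (v k * cnj (g k))) \<le> sqrt (\<Sum>k\<in>G. hs_weight s v k) * sqrt (\<Sum>k\<in>G. hs_weight (- s) g k)"
proof -
  have "(\<Sum>k\<in>G. cmod (v k * cnj (g k))) =
     (\<Sum>k\<in>G. (\<bar>of_int k\<bar> powr s * cmod (v k)) * (\<bar>of_int k\<bar> powr (- s) * cmod (g k)))"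
  proof (intro sum.cong refl)
    fix k assume "k \<in> G"
    then have "\<bar>real_of_int k\<bar> powr s * \<bar>real_of_int k\<bar> powr (- s) = 1"
      using assms by (auto simp: Z0_def simp flip: powr_add)
    then show "cmod (v k * cnj (g k)) = (\<bar>of_int k\<bar> powr s * cmod (v k)) * (\<bar>of_int k\<bar> powr (- s) * cmod (g k))"
      by (simp add: norm_mult mult_ac)
  qed
  also have "\<dots> \<le> sqrt (\<Sum>k\<in>G. (\<bar>of_int k\<bar> powr s * cmod (v k))\<^sup>2) * sqrt (\<Sum>k\<in>G. (\<bar>of_int k\<bar> powr (- s) * cmod (g k))\<^sup>2)"
    by (rule sum_mult_le_sqrt)
  also have "\<dots> = sqrt (\<Sum>k\<in>G. hs_weight s v k) * sqrt (\<Sum>k\<in>G. hs_weight (- s) g k)"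
    by (simp add: power_mult_distrib powr_square hs_weight_def)
  finally show ?thesis .
qed

lemma norm_pairing_le:
  assumes v: "in_hs s v" and g: "in_hs (- s) g"
  shows "cmod (pairing v g) \<le> hs_norm s v * hs_norm (- s) g"
proof -
  have fin: "(\<Sum>k\<in>G. cmod (v k * cnj (g k))) \<le> hs_norm s v * hs_norm (- s) g" if "finite G" "G \<subseteq> Z0" for G
  proof -
    have "sqrt (\<Sum>k\<in>G. hs_weight s v k) * sqrt (\<Sum>k\<in>G. hs_weight (- s) g k) \<le> hs_norm s v * hs_norm (- s) g"
      using that v g by (intro mult_mono real_le_lsqrt sum_hs_weight_le) (auto intro: sum_nonneg)
    then show ?thesis using sum_pairing_le[OF that(2), of v g s] by linarith
  qed
  have sum: "(\<lambda>k. cmod (v k * cnj (g k))) summable_on Z0"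
    using fin by (intro nonneg_bdd_above_summable_on bdd_aboveI2[of _ _ "hs_norm s v * hs_norm (- s) g"]) auto
  have "cmod (pairing v g) \<le> infsum (\<lambda>k. cmod (v k * cnj (g k))) Z0"
    unfolding pairing_def by (rule norm_infsum_bound) (rule sum)
  also have "\<dots> \<le> hs_norm s v * hs_norm (- s) g"
    by (rule infsum_le_finite_sums[OF sum]) (use fin in auto)
  finally show ?thesis .
qed

text \<open>Cauchy-Schwarz, keeping only the part of the first factor on \<open>G\<close>: this
  becomes small when \<open>G\<close> avoids low frequencies, which gives the uniform tails for the
  nonlinearity.\<close>

lemma sum_convolution_le:
  assumes w: "in_hs 0 w" and G: "finite G" "G \<subseteq> {d. d \<noteq> 0 \<and> k - d \<noteq> 0}"
  shows "(\<Sum>d\<in>G. cmod (w d) * cmod (w (k - d))) \<le> sqrt (\<Sum>d\<in>G. hs_weight 0 w d) * hs_norm 0 w"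
proof -
  have 1: "(\<Sum>d\<in>G. (cmod (w d))\<^sup>2) = (\<Sum>d\<in>G. hs_weight 0 w d)"
    using G by (intro sum.cong) (auto simp: hs_weight_0)
  have "(\<Sum>d\<in>G. (cmod (w (k - d)))\<^sup>2) = (\<Sum>d\<in>(\<lambda>d. k - d) ` G. (cmod (w d))\<^sup>2)"
    by (subst sum.reindex) (auto simp: inj_on_def)
  also have "\<dots> = (\<Sum>d\<in>(\<lambda>d. k - d) ` G. hs_weight 0 w d)"
    using G by (intro sum.cong) (auto simp: hs_weight_0)
  also have "\<dots> \<le> (hs_norm 0 w)\<^sup>2"
    using G w by (intro sum_hs_weight_le) (auto simp: Z0_def)
  finally have "sqrt (\<Sum>d\<in>G. (cmod (w (k - d)))\<^sup>2) \<le> hs_norm 0 w"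
    by (intro real_le_lsqrt) auto
  then have "sqrt (\<Sum>d\<in>G. (cmod (w d))\<^sup>2) * sqrt (\<Sum>d\<in>G. (cmod (w (k - d)))\<^sup>2) \<le> sqrt (\<Sum>d\<in>G. hs_weight 0 w d) * hs_norm 0 w"
    unfolding 1 by (intro mult_left_mono) (auto intro: sum_nonneg)
  then show ?thesis using sum_mult_le_sqrt[of "\<lambda>d. cmod (w d)" "\<lambda>d. cmod (w (k - d))" G] by linarith
qed

text \<open>The bound depends on \<open>k\<close> but not on \<open>m\<close> or \<open>t\<close>;
  with conserved mass it yields both equicontinuity of each mode and the dominating constant for the
  time integrals.\<close>

lemma norm_galerkin_rhs_le:
  assumes w: "in_hs 0 w"
  shows "cmod (galerkin_rhs m w t k) \<le> \<bar>of_int k\<bar> / 2 * (hs_norm 0 w)\<^sup>2"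
proof (cases "k \<in> freqs m")
  case True
  have "cmod (galerkin_rhs m w t k) = \<bar>of_int k\<bar> / 2 * cmod (\<Sum>d\<in>splits m k. osc d (k - d) (- k) t * w d * w (k - d))"
    using True by (simp add: galerkin_rhs_eq norm_mult)
  also have "\<dots> \<le> \<bar>of_int k\<bar> / 2 * (\<Sum>d\<in>splits m k. cmod (w d) * cmod (w (k - d)))"
    by (intro mult_left_mono sum_norm_le) (auto simp: norm_mult)
  also have "\<dots> \<le> \<bar>of_int k\<bar> / 2 * (hs_norm 0 w * hs_norm 0 w)"
  proof (intro mult_left_mono)
    have "(\<Sum>d\<in>splits m k. cmod (w d) * cmod (w (k - d))) \<le> sqrt (\<Sum>d\<in>splits m k. hs_weight 0 w d) * hs_norm 0 w"
      by (rule sum_convolution_le[OF w finite_splits]) (auto simp: splits_def freqs_def)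
    also have "\<dots> \<le> hs_norm 0 w * hs_norm 0 w"
    proof (intro mult_right_mono real_le_lsqrt)
      show "(\<Sum>d\<in>splits m k. hs_weight 0 w d) \<le> (hs_norm 0 w)\<^sup>2"
        using freqs_subset_Z0 by (intro sum_hs_weight_le w finite_splits) (auto simp: splits_def)
    qed (auto intro: sum_nonneg)
    finally show "(\<Sum>d\<in>splits m k. cmod (w d) * cmod (w (k - d))) \<le> hs_norm 0 w * hs_norm 0 w" .
  qed simp
  finally show ?thesis by (simp add: power2_eq_square)
next
  case False
  then have "galerkin_rhs m w t k = 0" by (auto simp: freqs_def galerkin_rhs_def)
  then show ?thesis by simp
qed

section \<open>Bounds for Galerkin solutions uniform in the cutoff\<close>

context galerkin
begin

lemma energy_initial_le:
  assumes "in_hs s v0"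
  shows "energy s 0 \<le> (hs_norm s v0)\<^sup>2"
proof -
  have "energy s 0 = (\<Sum>k\<in>freqs m. hs_weight s v0 k)"
    by (simp add: energy_def hs_weight_def initial)
  then show ?thesis using assms sum_hs_weight_le freqs_subset_Z0 by simp
qed

text \<open>Modes below the cutoff are controlled by \<open>energy_le\<close>; those above keep
  their initial values and contribute the second summand.\<close>

lemma hs_bound:
  assumes s: "0 \<le> s" "in_hs s v0" and t: "0 \<le> t" "t \<le> T" and G: "finite G" "G \<subseteq> Z0"
  shows "(\<Sum>k\<in>G. hs_weight s (u t) k) \<le>
    apriori_bound s T ((hs_norm 0 v0)\<^sup>2) ((hs_norm s v0)\<^sup>2) + (hs_norm s v0)\<^sup>2"
proof -
  have "in_hs 0 v0" using in_hs_mono s by blast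
  have "(\<Sum>k\<in>G. hs_weight s (u t) k) = (\<Sum>k\<in>G \<inter> freqs m. hs_weight s (u t) k) + (\<Sum>k\<in>G - freqs m. hs_weight s (u t) k)"
    using G by (intro sum.Int_Diff) auto
  also have "(\<Sum>k\<in>G \<inter> freqs m. hs_weight s (u t) k) \<le> (\<Sum>k\<in>freqs m. hs_weight s (u t) k)"
    by (intro sum_mono2) auto
  also have "\<dots> = energy s t" by (simp add: energy_def hs_weight_def)
  also have "\<dots> \<le> apriori_bound s T ((hs_norm 0 v0)\<^sup>2) ((hs_norm s v0)\<^sup>2)"
    using s t \<open>in_hs 0 v0\<close> by (intro energy_le energy_initial_le)
  also have "(\<Sum>k\<in>G - freqs m. hs_weight s (u t) k) = (\<Sum>k\<in>G - freqs m. hs_weight s v0 k)"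
    using G t const_mode by (intro sum.cong) (auto simp: hs_weight_def freqs_def Z0_def)
  also have "\<dots> \<le> (hs_norm s v0)\<^sup>2"
    using G s by (intro sum_hs_weight_le) auto
  finally show ?thesis by simp
qed

lemma mass_conserved:
  assumes v0: "in_hs 0 v0" and t: "0 \<le> t"
  shows "in_hs 0 (u t)" and "hs_norm 0 (u t) = hs_norm 0 v0"
proof -
  have high: "hs_weight 0 (u t) k = hs_weight 0 v0 k" if "k \<in> Z0 - freqs m" for k
    using that t const_mode by (auto simp: hs_weight_def freqs_def Z0_def)
  have sum0: "hs_weight 0 v0 summable_on (Z0 - freqs m)"
    using v0 unfolding in_hs_def by (rule summable_on_subset_banach) auto
  then have sumt: "hs_weight 0 (u t) summable_on (Z0 - freqs m)"
    using high summable_on_cong by blast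
  have Z0: "freqs m \<union> (Z0 - freqs m) = Z0" using freqs_subset_Z0 by auto
  have "hs_weight 0 (u t) summable_on (freqs m \<union> (Z0 - freqs m))"
    using sumt by (intro summable_on_Un_disjoint) auto
  then show "in_hs 0 (u t)" unfolding in_hs_def Z0 .
  have fin: "(\<Sum>k\<in>freqs m. hs_weight 0 (u t) k) = (\<Sum>k\<in>freqs m. hs_weight 0 v0 k)"
    using energy_0_conserved[OF t] by (simp add: energy_def hs_weight_def initial)
  have "infsum (hs_weight 0 (u t)) (freqs m \<union> (Z0 - freqs m)) = infsum (hs_weight 0 v0) (freqs m \<union> (Z0 - freqs m))"
    using sumt sum0 fin high by (simp add: infsum_Un_disjoint del: Un_Diff_cancel) (intro infsum_cong, auto)
  then show "hs_norm 0 (u t) = hs_norm 0 v0" unfolding hs_norm_def Z0 by simp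
qed

lemma mode_le:
  assumes v0: "in_hs 0 v0" and "0 \<le> t" "k \<noteq> 0"
  shows "cmod (u t k) \<le> hs_norm 0 v0"
  using sum_hs_weight_le[OF mass_conserved(1)[OF v0, of t], of "{k}"] assms
  by (simp add: Z0_def hs_weight_0 mass_conserved(2) abs_le_square_iff[symmetric])

lemma lipschitz:
  assumes v0: "in_hs 0 v0" and k: "k \<noteq> 0" and t: "0 \<le> t" "0 \<le> t'"
  shows "cmod (u t k - u t' k) \<le> \<bar>of_int k\<bar> / 2 * (hs_norm 0 v0)\<^sup>2 * \<bar>t - t'\<bar>"
proof -
  have "cmod (u t k - u t' k) \<le> \<bar>of_int k\<bar> / 2 * (hs_norm 0 v0)\<^sup>2 * norm (t - t')"
  proof (rule differentiable_bound[of "{0..}"])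
    fix x :: real assume "x \<in> {0..}"
    then have x: "0 \<le> x" by simp
    show "((\<lambda>\<tau>. u \<tau> k) has_derivative (\<lambda>h. h *\<^sub>R galerkin_rhs m (u x) x k)) (at x within {0..})"
      using deriv[OF k x] by (simp add: has_vector_derivative_def)
    have "cmod (galerkin_rhs m (u x) x k) \<le> \<bar>of_int k\<bar> / 2 * (hs_norm 0 v0)\<^sup>2"
      using norm_galerkin_rhs_le[of "u x" m x k] mass_conserved[OF v0 x] by simp
    then show "onorm (\<lambda>h. h *\<^sub>R galerkin_rhs m (u x) x k) \<le> \<bar>of_int k\<bar> / 2 * (hs_norm 0 v0)\<^sup>2"
      by (intro onorm_le) (metis norm_scaleR real_norm_def mult.commute mult_left_mono abs_ge_zero)
  qed (use t in auto)
  then show ?thesis by simp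
qed

lemma continuous_rhs: "continuous_on {0..} (\<lambda>t. galerkin_rhs m (u t) t k)"
proof (cases "\<bar>k\<bar> \<le> int m")
  case True
  then show ?thesis
    unfolding galerkin_rhs_def by (auto intro!: continuous_intros continuous)
qed (simp add: galerkin_rhs_def)

lemma integral_eq:
  assumes k: "k \<noteq> 0" and t: "0 \<le> t"
  shows "(LINT \<tau>:{0..t}|lborel. galerkin_rhs m (u \<tau>) \<tau> k) = u t k - v0 k"
proof -
  have "(LINT \<tau>:{0..t}|lborel. galerkin_rhs m (u \<tau>) \<tau> k) = u t k - u 0 k"
    unfolding set_lebesgue_integral_def
  proof (rule integral_FTC_atLeastAtMost[OF t])
    show "((\<lambda>\<tau>. u \<tau> k) has_vector_derivative galerkin_rhs m (u x) x k) (at x within {0..t})" if "0 \<le> x" "x \<le> t" for x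
      using deriv[OF k that(1)] by (rule has_vector_derivative_within_subset) auto
    show "continuous_on {0..t} (\<lambda>x. galerkin_rhs m (u x) x k)"
      by (rule continuous_on_subset[OF continuous_rhs]) auto
  qed
  then show ?thesis by (simp add: initial)
qed

end

section \<open>Properties of a pointwise limit of Galerkin solutions\<close>

text \<open>Isolates what the extraction of a subsequence provides: cutoffs tending to infinity, one
  bound \<open>B\<close>, and convergence of every mode at every time. \<open>V_0\<close> fixes the
  meaningless mode 0, since \<open>in_Linf\<close> asks for measurability at every index.\<close>

locale galerkin_limit =
  fixes v0 :: "int \<Rightarrow> complex" and s T B :: real and m :: "nat \<Rightarrow> nat"
    and U :: "nat \<Rightarrow> real \<Rightarrow> int \<Rightarrow> complex" and V :: "real \<Rightarrow> int \<Rightarrow> complex"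
  assumes s: "0 < s" and T: "0 < T" and v0: "v0 \<in> Hdot s"
    and cutoff: "filterlim m at_top sequentially"
    and sol: "galerkin v0 (m j) (U j)"
    and bound: "t \<in> {0..T} \<Longrightarrow> finite G \<Longrightarrow> G \<subseteq> Z0 \<Longrightarrow> (\<Sum>k\<in>G. hs_weight s (U j t) k) \<le> B"
    and conv: "t \<in> {0..T} \<Longrightarrow> k \<noteq> 0 \<Longrightarrow> (\<lambda>j. U j t k) \<longlonglongrightarrow> V t k"
    and V_0: "V t 0 = 0"
begin

abbreviation time :: "real \<Rightarrow> real measure" where
  "time t \<equiv> restrict_space lborel {0..t}"

lemma v0_in_hs_0: "in_hs 0 v0"
  using v0 s in_hs_mono[of 0 s v0] by (simp add: Hdot_def)

lemma B_nonneg: "0 \<le> B"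
  using bound[of 0 "{}"] T by simp

lemma U_in_hs: "t \<in> {0..T} \<Longrightarrow> in_hs s (U j t)"
  by (rule in_hsI(1)[of s _ B]) (rule bound)

lemma U_norm: "t \<in> {0..T} \<Longrightarrow> (hs_norm s (U j t))\<^sup>2 \<le> B"
  by (rule in_hsI(2)) (rule bound)

lemma U_mass: "t \<in> {0..T} \<Longrightarrow> in_hs 0 (U j t)" "t \<in> {0..T} \<Longrightarrow> hs_norm 0 (U j t) = hs_norm 0 v0"
  using galerkin.mass_conserved[OF sol v0_in_hs_0] by auto

lemma V_bound:
  assumes t: "t \<in> {0..T}" and G: "finite G" "G \<subseteq> Z0"
  shows "(\<Sum>k\<in>G. hs_weight s (V t) k) \<le> B"
proof (rule LIMSEQ_le_const2)
  show "(\<lambda>j. \<Sum>k\<in>G. hs_weight s (U j t) k) \<longlonglongrightarrow> (\<Sum>k\<in>G. hs_weight s (V t) k)"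
    unfolding hs_weight_def using G t conv
    by (intro tendsto_sum tendsto_mult_left tendsto_power tendsto_norm) (auto simp: Z0_def)
qed (use bound[OF t G] in auto)

lemma V_in_hs: "t \<in> {0..T} \<Longrightarrow> in_hs s (V t)"
  by (rule in_hsI(1)[of s _ B]) (rule V_bound)

lemma V_norm: "t \<in> {0..T} \<Longrightarrow> (hs_norm s (V t))\<^sup>2 \<le> B"
  by (rule in_hsI(2)) (rule V_bound)

lemma V_real:
  assumes "t \<in> {0..T}" "k \<noteq> 0"
  shows "V t (- k) = cnj (V t k)"
proof (rule LIMSEQ_unique)
  show "(\<lambda>j. U j t (- k)) \<longlonglongrightarrow> V t (- k)" using assms by (intro conv) auto
  show "(\<lambda>j. U j t (- k)) \<longlonglongrightarrow> cnj (V t k)"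
    using assms conv[of t k] galerkin.reality[OF sol, of k t] by (auto intro: tendsto_cnj)
qed

lemma V_Hdot: "t \<in> {0..T} \<Longrightarrow> \<sigma> \<le> s \<Longrightarrow> V t \<in> Hdot \<sigma>"
  using V_real V_in_hs in_hs_mono by (auto simp: Hdot_def Z0_def)

text \<open>Beyond frequency \<open>N\<close>, passing from \<open>s\<close> down to
  \<open>\<sigma>\<close> gains a negative power of \<open>N\<close>. The same \<open>N\<close>
  serves all sequences with bound \<open>B\<close>, hence all \<open>U j t\<close> and
  \<open>V t\<close>.\<close>

lemma tails:
  assumes \<sigma>: "\<sigma> < s" and \<epsilon>: "0 < \<epsilon>"
  obtains N where "\<And>w G. (\<And>G. finite G \<Longrightarrow> G \<subseteq> Z0 \<Longrightarrow> (\<Sum>k\<in>G. hs_weight s w k) \<le> B) \<Longrightarrow>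
    finite G \<Longrightarrow> G \<subseteq> Z0 - freqs N \<Longrightarrow> (\<Sum>k\<in>G. hs_weight \<sigma> w k) \<le> \<epsilon>"
proof -
  have "(\<lambda>N. real (Suc N) powr (2 * (\<sigma> - s)) * B) \<longlonglongrightarrow> 0"
    using \<sigma> by (intro tendsto_mult_left_zero tendsto_neg_powr
        filterlim_compose[OF filterlim_real_sequentially filterlim_Suc]) auto
  from order_tendstoD(2)[OF this \<epsilon>] obtain N where N: "real (Suc N) powr (2 * (\<sigma> - s)) * B < \<epsilon>"
    unfolding eventually_sequentially by auto
  show thesis
  proof (rule that[of N])
    fix w G assume w: "\<And>G. finite G \<Longrightarrow> G \<subseteq> Z0 \<Longrightarrow> (\<Sum>k\<in>G. hs_weight s w k) \<le> B"
      and G: "finite G" "G \<subseteq> Z0 - freqs N"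
    have "(\<Sum>k\<in>G. hs_weight \<sigma> w k) \<le> (\<Sum>k\<in>G. real (Suc N) powr (2 * (\<sigma> - s)) * hs_weight s w k)"
      using G \<sigma> by (intro sum_mono hs_weight_le_high) (auto simp: Z0_def freqs_def)
    also have "\<dots> \<le> real (Suc N) powr (2 * (\<sigma> - s)) * B"
      using G by (subst sum_distrib_left[symmetric]) (intro mult_left_mono w, auto)
    finally show "(\<Sum>k\<in>G. hs_weight \<sigma> w k) \<le> \<epsilon>" using N by linarith
  qed
qed

lemma strong_conv:
  assumes \<sigma>: "\<sigma> < s" and t: "t \<in> {0..T}"
  shows "(\<lambda>j. hs_norm \<sigma> (\<lambda>k. U j t k - V t k)) \<longlonglongrightarrow> 0"
proof -
  have "(\<lambda>j. infsum (hs_weight \<sigma> (\<lambda>k. U j t k - V t k)) Z0) \<longlonglongrightarrow> infsum (\<lambda>k. 0) Z0"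
  proof (rule infsum_tendsto_uniform_tails(2))
    fix k :: int assume "k \<in> Z0"
    then have "(\<lambda>j. U j t k) \<longlonglongrightarrow> V t k" using t by (intro conv) (auto simp: Z0_def)
    then have "(\<lambda>j. \<bar>of_int k\<bar> powr (2 * \<sigma>) * (cmod (U j t k - V t k))\<^sup>2) \<longlonglongrightarrow> \<bar>of_int k\<bar> powr (2 * \<sigma>) * (cmod (V t k - V t k))\<^sup>2"
      by (intro tendsto_intros)
    then show "(\<lambda>j. hs_weight \<sigma> (\<lambda>k. U j t k - V t k) k) \<longlonglongrightarrow> 0" by (simp add: hs_weight_def)
  next
    fix \<epsilon> :: real assume \<epsilon>: "0 < \<epsilon>"
    \<comment> \<open>The weight of a difference is at most twice each single weight, so two tails
      of \<open>\<epsilon> / 4\<close> add up to \<open>\<epsilon>\<close>.\<close>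
    then obtain N where N: "\<And>w G. (\<And>G. finite G \<Longrightarrow> G \<subseteq> Z0 \<Longrightarrow> (\<Sum>k\<in>G. hs_weight s w k) \<le> B) \<Longrightarrow>
      finite G \<Longrightarrow> G \<subseteq> Z0 - freqs N \<Longrightarrow> (\<Sum>k\<in>G. hs_weight \<sigma> w k) \<le> \<epsilon> / 4"
      using tails[OF \<sigma>, of "\<epsilon> / 4"] by (metis zero_less_divide_iff zero_less_numeral)
    have "(\<Sum>k\<in>G. norm (hs_weight \<sigma> (\<lambda>k. U j t k - V t k) k)) \<le> \<epsilon>" if G: "finite G" "G \<subseteq> Z0 - freqs N" for j G
    proof -
      have "(\<Sum>k\<in>G. norm (hs_weight \<sigma> (\<lambda>k. U j t k - V t k) k)) \<le> (\<Sum>k\<in>G. 2 * hs_weight \<sigma> (U j t) k + 2 * hs_weight \<sigma> (V t) k)"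
        by (intro sum_mono) (simp add: hs_weight_diff_le)
      also have "\<dots> = 2 * (\<Sum>k\<in>G. hs_weight \<sigma> (U j t) k) + 2 * (\<Sum>k\<in>G. hs_weight \<sigma> (V t) k)"
        by (simp add: sum.distrib sum_distrib_left)
      also have "\<dots> \<le> 2 * (\<epsilon> / 4) + 2 * (\<epsilon> / 4)"
        using N[OF bound[OF t] G] N[OF V_bound[OF t] G] by (intro add_mono mult_left_mono) auto
      finally show ?thesis by simp
    qed
    then show "\<exists>F. finite F \<and> F \<subseteq> Z0 \<and> (\<forall>j G. finite G \<longrightarrow> G \<subseteq> Z0 - F \<longrightarrow>
        (\<Sum>k\<in>G. norm (hs_weight \<sigma> (\<lambda>k. U j t k - V t k) k)) \<le> \<epsilon>)"
      using freqs_subset_Z0 by (intro exI[of _ "freqs N"]) auto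
  qed
  then have "(\<lambda>j. sqrt (infsum (hs_weight \<sigma> (\<lambda>k. U j t k - V t k)) Z0)) \<longlonglongrightarrow> sqrt 0"
    by (intro tendsto_real_sqrt) simp
  then show ?thesis by (simp add: hs_norm_def)
qed

text \<open>Positivity of \<open>s\<close> makes the tails at level 0 uniformly small, so no mass
  escapes to infinite frequency and equality survives the limit, at every time.\<close>

lemma V_mass:
  assumes t: "t \<in> {0..T}"
  shows "hs_norm 0 (V t) = hs_norm 0 v0"
proof -
  have "(\<lambda>j. infsum (hs_weight 0 (U j t)) Z0) \<longlonglongrightarrow> infsum (hs_weight 0 (V t)) Z0"
  proof (rule infsum_tendsto_uniform_tails(2))
    fix k :: int assume "k \<in> Z0"
    then show "(\<lambda>j. hs_weight 0 (U j t) k) \<longlonglongrightarrow> hs_weight 0 (V t) k"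
      unfolding hs_weight_def using t conv by (intro tendsto_intros) (auto simp: Z0_def)
  next
    fix \<epsilon> :: real assume \<epsilon>: "0 < \<epsilon>"
    then obtain N where "\<And>w G. (\<And>G. finite G \<Longrightarrow> G \<subseteq> Z0 \<Longrightarrow> (\<Sum>k\<in>G. hs_weight s w k) \<le> B) \<Longrightarrow>
      finite G \<Longrightarrow> G \<subseteq> Z0 - freqs N \<Longrightarrow> (\<Sum>k\<in>G. hs_weight 0 w k) \<le> \<epsilon>"
      using tails[OF s] by metis
    then show "\<exists>F. finite F \<and> F \<subseteq> Z0 \<and> (\<forall>j G. finite G \<longrightarrow> G \<subseteq> Z0 - F \<longrightarrow>
        (\<Sum>k\<in>G. norm (hs_weight 0 (U j t) k)) \<le> \<epsilon>)"
      using freqs_subset_Z0 bound[OF t] by (intro exI[of _ "freqs N"]) auto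
  qed
  then have "(\<lambda>j. (hs_norm 0 (U j t))\<^sup>2) \<longlonglongrightarrow> (hs_norm 0 (V t))\<^sup>2" by (simp add: hs_norm_squared)
  then have "(\<lambda>j. (hs_norm 0 v0)\<^sup>2) \<longlonglongrightarrow> (hs_norm 0 (V t))\<^sup>2"
    unfolding U_mass(2)[OF t] .
  then have "(hs_norm 0 v0)\<^sup>2 = (hs_norm 0 (V t))\<^sup>2" by (simp add: LIMSEQ_const_iff)
  then show ?thesis by (simp add: power2_eq_iff_nonneg)
qed

lemma time_set [simp]: "{0..t::real} \<in> sets borel"
  by measurable

lemma finite_time [simp]: "emeasure (time t) (space (time t)) < \<infinity>"
  by (simp add: emeasure_restrict_space space_restrict_space emeasure_lborel_Icc_eq)

lemma integrable_const_time [simp]: "integrable (time t) (\<lambda>_. c :: real)"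
  by (rule finite_measure.integrable_const, rule finite_measureI) (use finite_time[of t] in \<open>simp add: less_top\<close>)

lemma space_time [simp]: "space (time t) = {0..t}"
  by (simp add: space_restrict_space)

lemma measurable_time:
  assumes "continuous_on {0..t} f"
  shows "f \<in> borel_measurable (time t)"
  using borel_measurable_continuous_on_restrict[OF assms]
  by (simp cong: measurable_cong_sets sets_restrict_space_cong)

lemma U_measurable: "k \<noteq> 0 \<Longrightarrow> (\<lambda>t. U j t k) \<in> borel_measurable (time t')"
  by (rule measurable_time, rule continuous_on_subset[OF galerkin.continuous[OF sol]]) auto

lemma V_measurable: "(\<lambda>t. V t k) \<in> borel_measurable (time T)"
proof (cases "k = 0")
  case False
  show ?thesis
  proof (rule borel_measurable_LIMSEQ_metric)
    show "(\<lambda>t. U j t k) \<in> borel_measurable (time T)" for j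
      by (rule U_measurable[OF False])
    show "(\<lambda>j. U j t k) \<longlonglongrightarrow> V t k" if "t \<in> space (time T)" for t
      using that False by (intro conv) auto
  qed
qed (simp add: V_0)

lemma Linf_s: "in_Linf T s V"
  unfolding in_Linf_def
proof (intro conjI allI V_measurable exI[of _ "sqrt B"] AE_I2 impI)
  fix t assume t: "t \<in> {0..T}"
  show "V t \<in> Hdot s" using V_Hdot[OF t] by simp
  show "hs_norm s (V t) \<le> sqrt B" using V_norm[OF t] by (rule real_le_rsqrt)
qed

lemma Linf_0: "in_Linf T 0 V"
  unfolding in_Linf_def
proof (intro conjI allI V_measurable exI[of _ "hs_norm 0 v0"] AE_I2 impI)
  fix t assume t: "t \<in> {0..T}"
  show "V t \<in> Hdot 0" using V_Hdot[OF t] s by simp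
  show "hs_norm 0 (V t) \<le> hs_norm 0 v0" using V_mass[OF t] by simp
qed

lemma diff_bound:
  assumes t: "t \<in> {0..T}" and \<sigma>: "\<sigma> \<le> s"
  shows "in_hs \<sigma> (\<lambda>k. U j t k - V t k)" and "hs_norm \<sigma> (\<lambda>k. U j t k - V t k) \<le> sqrt (4 * B)"
proof -
  have "(\<Sum>k\<in>G. hs_weight \<sigma> (\<lambda>k. U j t k - V t k) k) \<le> 4 * B" if G: "finite G" "G \<subseteq> Z0" for G
  proof -
    have "(\<Sum>k\<in>G. hs_weight \<sigma> (\<lambda>k. U j t k - V t k) k) \<le> (\<Sum>k\<in>G. 2 * hs_weight s (U j t) k + 2 * hs_weight s (V t) k)"
    proof (intro sum_mono)
      fix k assume "k \<in> G"
      then have "k \<noteq> 0" using G by (auto simp: Z0_def)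
      have "hs_weight \<sigma> (\<lambda>k. U j t k - V t k) k \<le> hs_weight s (\<lambda>k. U j t k - V t k) k"
        by (rule hs_weight_mono) fact+
      also have "\<dots> \<le> 2 * hs_weight s (U j t) k + 2 * hs_weight s (V t) k"
        by (rule hs_weight_diff_le)
      finally show "hs_weight \<sigma> (\<lambda>k. U j t k - V t k) k \<le> 2 * hs_weight s (U j t) k + 2 * hs_weight s (V t) k" .
    qed
    also have "\<dots> = 2 * (\<Sum>k\<in>G. hs_weight s (U j t) k) + 2 * (\<Sum>k\<in>G. hs_weight s (V t) k)"
      by (simp add: sum.distrib sum_distrib_left)
    also have "\<dots> \<le> 2 * B + 2 * B"
      using bound[OF t G] V_bound[OF t G] by (intro add_mono mult_left_mono) auto
    finally show ?thesis by simp
  qed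
  note fin = this
  show "in_hs \<sigma> (\<lambda>k. U j t k - V t k)" by (rule in_hsI(1)[of \<sigma> _ "4 * B"]) (rule fin)
  have "(hs_norm \<sigma> (\<lambda>k. U j t k - V t k))\<^sup>2 \<le> 4 * B" by (rule in_hsI(2)) (rule fin)
  then show "hs_norm \<sigma> (\<lambda>k. U j t k - V t k) \<le> sqrt (4 * B)" by (rule real_le_rsqrt)
qed

lemma nn_integral_time: "(\<integral>\<^sup>+ t\<in>{0..t'}. f t \<partial>lborel) = (\<integral>\<^sup>+ t. f t \<partial>time t')"
  by (simp add: nn_integral_restrict_space)

lemma set_integral_time: "(LINT t:{0..t'}|lborel. (f t :: complex)) = (\<integral>t. f t \<partial>time t')"
  by (simp add: set_lebesgue_integral_def integral_restrict_space)

lemma AE_time: "(AE t in time t'. P t) \<longleftrightarrow> (AE t in lborel. t \<in> {0..t'} \<longrightarrow> P t)"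
  by (simp add: AE_restrict_space_iff)

text \<open>Strong convergence holds at each time and the norms are bounded by a constant, so
  dominated convergence on the bounded interval gives every exponent at once.\<close>

lemma Lp_conv:
  assumes \<sigma>: "\<sigma> < s" and p: "0 < p"
  shows "Lp_converges T \<sigma> p U V"
proof -
  define f where "f = (\<lambda>j t. hs_norm \<sigma> (\<lambda>k. U j t k - V t k) powr p)"
  have f: "f j \<in> borel_measurable (time T)" for j
  proof -
    have "(\<lambda>t. hs_norm \<sigma> (\<lambda>k. U j t k - V t k)) \<in> borel_measurable (time T)"
      by (rule borel_measurable_hs_norm, intro borel_measurable_diff U_measurable V_measurable)
    then show ?thesis unfolding f_def by simp
  qed
  have "(\<lambda>j. \<integral>\<^sup>+ t. ennreal (f j t) \<partial>time T) \<longlonglongrightarrow> (\<integral>\<^sup>+ t. 0 \<partial>time T)"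
  proof (rule nn_integral_dominated_convergence[where w = "\<lambda>_. ennreal (sqrt (4 * B) powr p)"])
    show "(\<lambda>t. ennreal (f j t)) \<in> borel_measurable (time T)" for j using f by simp
    show "AE t in time T. ennreal (f j t) \<le> ennreal (sqrt (4 * B) powr p)" for j
      unfolding AE_time f_def using diff_bound(2) \<sigma> p
      by (intro AE_I2 impI ennreal_leI powr_mono2) (auto simp: less_imp_le)
    show "(\<integral>\<^sup>+ t. ennreal (sqrt (4 * B) powr p) \<partial>time T) < \<infinity>"
      using finite_time[of T] by (simp add: ennreal_mult_less_top ennreal_mult_eq_top_iff less_top[symmetric] del: space_time)
    show "AE t in time T. (\<lambda>j. ennreal (f j t)) \<longlonglongrightarrow> 0"
      unfolding AE_time
    proof (intro AE_I2 impI)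
      fix t assume "t \<in> {0..T}"
      then have "(\<lambda>j. f j t) \<longlonglongrightarrow> 0"
        unfolding f_def using p by (intro tendsto_zero_powrI[OF strong_conv[OF \<sigma>] tendsto_const]) auto
      then have "(\<lambda>j. ennreal (f j t)) \<longlonglongrightarrow> ennreal 0" by (rule tendsto_ennrealI)
      then show "(\<lambda>j. ennreal (f j t)) \<longlonglongrightarrow> 0" by simp
    qed
  qed auto
  then show ?thesis
    unfolding Lp_converges_def nn_integral_time f_def using diff_bound(1) \<sigma> by auto
qed

text \<open>At regularity \<open>s\<close> itself the tails of \<open>U j t\<close> need not be
  uniformly small. Smallness comes instead from the tail of the fixed test sequence
  \<open>g t\<close>, paired with the uniform bound on \<open>U j t\<close>; in time,
  \<open>sqrt B\<close> times the norm of \<open>g t\<close> dominates.\<close>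

lemma weakstar_conv: "weakstar_converges T s U V"
  unfolding weakstar_converges_def set_integral_time nn_integral_time AE_time[symmetric]
proof (intro allI impI, elim conjE)
  fix g :: "real \<Rightarrow> int \<Rightarrow> complex"
  assume gm: "\<forall>k. (\<lambda>t. g t k) \<in> borel_measurable (time T)"
    and gs: "AE t in time T. in_hs (- s) (g t)"
    and gi: "(\<integral>\<^sup>+ t. ennreal (hs_norm (- s) (g t)) \<partial>time T) < \<infinity>"
  show "(\<lambda>j. \<integral>t. pairing (U j t) (g t) \<partial>time T) \<longlonglongrightarrow> (\<integral>t. pairing (V t) (g t) \<partial>time T)"
  proof (rule integral_dominated_convergence[where w = "\<lambda>t. sqrt B * hs_norm (- s) (g t)"])
    show "(\<lambda>t. pairing (V t) (g t)) \<in> borel_measurable (time T)"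
      using gm by (intro borel_measurable_pairing V_measurable) auto
    show "(\<lambda>t. pairing (U j t) (g t)) \<in> borel_measurable (time T)" for j
      using gm by (intro borel_measurable_pairing U_measurable) auto
    have "(\<lambda>t. hs_norm (- s) (g t)) \<in> borel_measurable (time T)"
      using gm by (intro borel_measurable_hs_norm) auto
    then show "integrable (time T) (\<lambda>t. sqrt B * hs_norm (- s) (g t))"
      using gi by (intro integrable_mult_right integrableI_nonneg) auto
    have U: "hs_norm s (U j t) \<le> sqrt B" if "t \<in> {0..T}" for j t
      using U_norm[OF that] by (rule real_le_rsqrt)
    have in_time: "AE t in time T. t \<in> {0..T}"
      unfolding AE_time by simp
    show "AE t in time T. cmod (pairing (U j t) (g t)) \<le> sqrt B * hs_norm (- s) (g t)" for j
      using gs in_time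
    proof eventually_elim
      case (elim t)
      have "cmod (pairing (U j t) (g t)) \<le> hs_norm s (U j t) * hs_norm (- s) (g t)"
        using elim U_in_hs by (intro norm_pairing_le) auto
      also have "\<dots> \<le> sqrt B * hs_norm (- s) (g t)" using U elim by (intro mult_right_mono) auto
      finally show ?case .
    qed
    show "AE t in time T. (\<lambda>j. pairing (U j t) (g t)) \<longlonglongrightarrow> pairing (V t) (g t)"
      using gs in_time
    proof eventually_elim
      case (elim t)
      show ?case unfolding pairing_def
      proof (rule infsum_tendsto_uniform_tails(2))
        show "(\<lambda>j. U j t k * cnj (g t k)) \<longlonglongrightarrow> V t k * cnj (g t k)" if "k \<in> Z0" for k
          using that elim by (intro tendsto_mult conv tendsto_const) (auto simp: Z0_def)
        fix \<epsilon> :: real assume \<epsilon>: "0 < \<epsilon>"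
        \<comment> \<open>Chosen so that \<open>sqrt B * sqrt \<delta> <= \<epsilon>\<close>; the
          added 1 covers \<open>B = 0\<close>.\<close>
        define \<delta> where "\<delta> = (\<epsilon> / (sqrt B + 1))\<^sup>2"
        have \<delta>: "0 < \<delta>" "sqrt \<delta> = \<epsilon> / (sqrt B + 1)"
          using \<epsilon> B_nonneg add_nonneg_pos[of "sqrt B" 1] by (auto simp: \<delta>_def)
        obtain F where F: "finite F" "F \<subseteq> Z0" "dist (\<Sum>k\<in>F. hs_weight (- s) (g t) k) (infsum (hs_weight (- s) (g t)) Z0) \<le> \<delta>"
          using infsum_finite_approximation[of "hs_weight (- s) (g t)" Z0 \<delta>] elim \<delta> by (auto simp: in_hs_def)
        have "(\<Sum>k\<in>G. norm (U j t k * cnj (g t k))) \<le> \<epsilon>" if G: "finite G" "G \<subseteq> Z0 - F" for j G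
        proof -
          have "(\<Sum>k\<in>G \<union> F. hs_weight (- s) (g t) k) \<le> infsum (hs_weight (- s) (g t)) Z0"
            using G F elim by (intro finite_sum_le_infsum) (auto simp: in_hs_def)
          moreover have "(\<Sum>k\<in>G \<union> F. hs_weight (- s) (g t) k) = (\<Sum>k\<in>G. hs_weight (- s) (g t) k) + (\<Sum>k\<in>F. hs_weight (- s) (g t) k)"
            using G F by (intro sum.union_disjoint) auto
          ultimately have gG: "(\<Sum>k\<in>G. hs_weight (- s) (g t) k) \<le> \<delta>" using F(3) by (auto simp: dist_real_def)
          have "(\<Sum>k\<in>G. norm (U j t k * cnj (g t k))) \<le> sqrt (\<Sum>k\<in>G. hs_weight s (U j t) k) * sqrt (\<Sum>k\<in>G. hs_weight (- s) (g t) k)"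
            using G by (intro sum_pairing_le) auto
          also have "\<dots> \<le> sqrt B * sqrt \<delta>"
            using gG bound[of t G j] G elim B_nonneg by (intro mult_mono) (auto intro: sum_nonneg)
          also have "\<dots> \<le> \<epsilon>" unfolding \<delta>(2) using B_nonneg \<epsilon> by (simp add: divide_simps add_nonneg_pos)
          finally show ?thesis .
        qed
        then show "\<exists>F. finite F \<and> F \<subseteq> Z0 \<and> (\<forall>j G. finite G \<longrightarrow> G \<subseteq> Z0 - F \<longrightarrow> (\<Sum>k\<in>G. norm (U j t k * cnj (g t k))) \<le> \<epsilon>)"
          using F by blast
      qed
    qed
  qed
qed

lemma rhs_conv:
  assumes t: "t \<in> {0..T}"
  shows "(\<lambda>j. galerkin_rhs (m j) (U j t) t k) \<longlonglongrightarrow> (1/2) * \<i> * of_int k * nonlin V k t"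
proof -
  define A where "A = {d::int. d \<noteq> 0 \<and> k - d \<noteq> 0}"
  define e where "e = (\<lambda>d. exp (3 * \<i> * of_int k * of_int d * of_int (k - d) * complex_of_real t))"
  \<comment> \<open>Extending the truncated convolution by zero puts all cutoffs on the common index
    set \<open>A\<close>; each fixed \<open>d\<close> in \<open>A\<close> lies in
    \<open>splits (m j) k\<close> for all large \<open>j\<close>.\<close>
  define a where "a = (\<lambda>j d. if d \<in> splits (m j) k then e d * U j t d * U j t (k - d) else 0)"
  have norm_e: "cmod (e d) = 1" for d
  proof -
    have "3 * \<i> * of_int k * of_int d * of_int (k - d) * complex_of_real t = \<i> * complex_of_real (3 * of_int k * of_int d * of_int (k - d) * t)"
      by simp
    then show ?thesis unfolding e_def by (metis norm_exp_i_times)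
  qed
  have "(\<lambda>j. infsum (a j) A) \<longlonglongrightarrow> infsum (\<lambda>d. e d * V t d * V t (k - d)) A"
  proof (rule infsum_tendsto_uniform_tails(2))
    fix d assume d: "d \<in> A"
    have "(\<lambda>j. e d * U j t d * U j t (k - d)) \<longlonglongrightarrow> e d * V t d * V t (k - d)"
      using d t by (intro tendsto_mult conv tendsto_const) (auto simp: A_def)
    moreover have "eventually (\<lambda>j. e d * U j t d * U j t (k - d) = a j d) sequentially"
    proof -
      have "eventually (\<lambda>j. nat \<bar>d\<bar> + nat \<bar>k - d\<bar> \<le> m j) sequentially"
        using cutoff by (simp add: filterlim_at_top)
      then show ?thesis
      proof eventually_elim
        case (elim j)
        then show ?case using d by (auto simp: a_def splits_def freqs_def A_def)
      qed
    qed
    ultimately show "(\<lambda>j. a j d) \<longlonglongrightarrow> e d * V t d * V t (k - d)"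
      by (rule Lim_transform_eventually)
  next
    fix \<epsilon> :: real assume \<epsilon>: "0 < \<epsilon>"
    define l where "l = hs_norm 0 v0"
    define \<delta> where "\<delta> = (\<epsilon> / (l + 1))\<^sup>2"
    have l: "0 \<le> l" by (simp add: l_def)
    have \<delta>: "0 < \<delta>" "sqrt \<delta> = \<epsilon> / (l + 1)" using \<epsilon> l by (auto simp: \<delta>_def add_nonneg_pos)
    obtain N where N: "\<And>w G. (\<And>G. finite G \<Longrightarrow> G \<subseteq> Z0 \<Longrightarrow> (\<Sum>k\<in>G. hs_weight s w k) \<le> B) \<Longrightarrow>
      finite G \<Longrightarrow> G \<subseteq> Z0 - freqs N \<Longrightarrow> (\<Sum>k\<in>G. hs_weight 0 w k) \<le> \<delta>"
      using tails[OF s \<delta>(1)] by metis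
    have "(\<Sum>d\<in>G. norm (a j d)) \<le> \<epsilon>" if G: "finite G" "G \<subseteq> A - (freqs N \<inter> A)" for j G
    proof -
      have "(\<Sum>d\<in>G. norm (a j d)) \<le> (\<Sum>d\<in>G. cmod (U j t d) * cmod (U j t (k - d)))"
        by (intro sum_mono) (auto simp: a_def norm_mult norm_e)
      also have "\<dots> \<le> sqrt (\<Sum>d\<in>G. hs_weight 0 (U j t) d) * hs_norm 0 (U j t)"
        using G by (intro sum_convolution_le U_mass t) (auto simp: A_def)
      also have "\<dots> \<le> sqrt \<delta> * l"
        unfolding U_mass(2)[OF t] l_def
        using G by (intro mult_right_mono real_sqrt_le_mono N bound[OF t]) (auto simp: A_def Z0_def)
      also have "\<dots> \<le> \<epsilon>" unfolding \<delta>(2) using l \<epsilon> by (simp add: divide_simps add_nonneg_pos)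
      finally show ?thesis .
    qed
    then show "\<exists>F. finite F \<and> F \<subseteq> A \<and> (\<forall>j G. finite G \<longrightarrow> G \<subseteq> A - F \<longrightarrow> (\<Sum>d\<in>G. norm (a j d)) \<le> \<epsilon>)"
      by (intro exI[of _ "freqs N \<inter> A"]) auto
  qed
  moreover have "infsum (\<lambda>d. e d * V t d * V t (k - d)) A = nonlin V k t"
    by (simp add: nonlin_def A_def e_def)
  ultimately have "(\<lambda>j. (1/2) * \<i> * of_int k * infsum (a j) A) \<longlonglongrightarrow> (1/2) * \<i> * of_int k * nonlin V k t"
    by (intro tendsto_mult_left) simp
  moreover have "eventually (\<lambda>j. (1/2) * \<i> * of_int k * infsum (a j) A = galerkin_rhs (m j) (U j t) t k) sequentially"
  proof -
    have "eventually (\<lambda>j. nat \<bar>k\<bar> \<le> m j) sequentially"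
      using cutoff by (simp add: filterlim_at_top)
    then show ?thesis
    proof eventually_elim
      case (elim j)
      have S: "{k1. k1 \<noteq> 0 \<and> k - k1 \<noteq> 0 \<and> \<bar>k1\<bar> \<le> int (m j) \<and> \<bar>k - k1\<bar> \<le> int (m j)} = splits (m j) k"
        by (auto simp: splits_def freqs_def)
      have "infsum (a j) A = infsum (a j) (splits (m j) k)"
        by (rule infsum_cong_neutral) (auto simp: a_def A_def splits_def freqs_def)
      also have "\<dots> = (\<Sum>d\<in>splits (m j) k. e d * U j t d * U j t (k - d))"
        by (simp add: a_def)
      finally have "infsum (a j) A = (\<Sum>d\<in>splits (m j) k. e d * U j t d * U j t (k - d))" .
      then show ?case
        unfolding galerkin_rhs_def S e_def using elim by simp
    qed
  qed
  ultimately show ?thesis by (rule Lim_transform_eventually)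
qed

lemma V_solution: "is_solution T v0 V"
  unfolding is_solution_def
proof (intro conjI ballI Linf_0)
  fix k t assume k: "k \<in> Z0" and t: "t \<in> {0..T}"
  define c where "c = (1/2) * \<i> * complex_of_int k"
  have c: "c \<noteq> 0" using k by (simp add: c_def Z0_def)
  have sub: "\<tau> \<in> {0..T}" if "\<tau> \<in> {0..t}" for \<tau> using that t by auto
  have meas: "(\<lambda>\<tau>. galerkin_rhs (m j) (U j \<tau>) \<tau> k) \<in> borel_measurable (time t)" for j
    by (rule measurable_time, rule continuous_on_subset[OF galerkin.continuous_rhs[OF sol]]) auto
  have conv': "AE \<tau> in time t. (\<lambda>j. galerkin_rhs (m j) (U j \<tau>) \<tau> k) \<longlonglongrightarrow> c * nonlin V k \<tau>"
    unfolding AE_time c_def by (intro AE_I2 impI rhs_conv sub)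
  have dom: "AE \<tau> in time t. cmod (galerkin_rhs (m j) (U j \<tau>) \<tau> k) \<le> \<bar>of_int k\<bar> / 2 * (hs_norm 0 v0)\<^sup>2" for j
    unfolding AE_time
  proof (intro AE_I2 impI)
    fix \<tau> assume "\<tau> \<in> {0..t}"
    then show "cmod (galerkin_rhs (m j) (U j \<tau>) \<tau> k) \<le> \<bar>of_int k\<bar> / 2 * (hs_norm 0 v0)\<^sup>2"
      using norm_galerkin_rhs_le[OF U_mass(1)[OF sub]] U_mass(2)[OF sub] by metis
  qed
  \<comment> \<open>Measurability in time is inherited from the continuous Galerkin right-hand sides
    through their pointwise limit.\<close>
  have lim_meas: "(\<lambda>\<tau>. c * nonlin V k \<tau>) \<in> borel_measurable (time t)"
  proof (rule borel_measurable_LIMSEQ_metric)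
    show "(\<lambda>\<tau>. galerkin_rhs (m j) (U j \<tau>) \<tau> k) \<in> borel_measurable (time t)" for j by (rule meas)
    show "(\<lambda>j. galerkin_rhs (m j) (U j \<tau>) \<tau> k) \<longlonglongrightarrow> c * nonlin V k \<tau>" if "\<tau> \<in> space (time t)" for \<tau>
      unfolding c_def using that by (intro rhs_conv sub) simp
  qed
  note dc = lim_meas meas integrable_const_time conv' dom
  have "integrable (time t) (\<lambda>\<tau>. c * nonlin V k \<tau>)"
    by (rule integrable_dominated_convergence[OF dc])
  \<comment> \<open>Dominated convergence gives integrability of \<open>c * nonlin V k\<close>; as
    \<open>k\<close> is nonzero, so is \<open>c\<close>, and it can be divided out.\<close>
  then have int: "integrable (time t) (nonlin V k)"
    using integrable_mult_right[of "inverse c" "time t" "\<lambda>\<tau>. c * nonlin V k \<tau>"] c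
    by (simp add: mult.assoc[symmetric])
  then show "set_integrable lborel {0..t} (nonlin V k)"
    by (simp add: set_integrable_def integrable_restrict_space)
  have "(\<lambda>j. \<integral>\<tau>. galerkin_rhs (m j) (U j \<tau>) \<tau> k \<partial>time t) \<longlonglongrightarrow> (\<integral>\<tau>. c * nonlin V k \<tau> \<partial>time t)"
    by (rule integral_dominated_convergence[OF dc])
  moreover have "(\<integral>\<tau>. galerkin_rhs (m j) (U j \<tau>) \<tau> k \<partial>time t) = U j t k - v0 k" for j
    using galerkin.integral_eq[OF sol, of k t] k t by (simp add: set_integral_time Z0_def)
  ultimately have "(\<lambda>j. U j t k - v0 k) \<longlonglongrightarrow> c * (\<integral>\<tau>. nonlin V k \<tau> \<partial>time t)" by simp
  moreover have "(\<lambda>j. U j t k - v0 k) \<longlonglongrightarrow> V t k - v0 k"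
    using k t by (intro tendsto_diff conv tendsto_const) (auto simp: Z0_def)
  ultimately have "V t k - v0 k = c * (\<integral>\<tau>. nonlin V k \<tau> \<partial>time t)"
    by (metis LIMSEQ_unique)
  then show "V t k - v0 k = (1/2) * \<i> * of_int k * (LINT \<tau>:{0..t}|lborel. nonlin V k \<tau>)"
    by (simp add: set_integral_time c_def)
qed

end

section \<open>Extraction of the subsequence and conclusion\<close>

text \<open>Equicontinuity upgrades convergence at rational times to convergence at all times.\<close>
lemma galerkin_convergent_subsequence:
  fixes vm :: "nat \<Rightarrow> real \<Rightarrow> int \<Rightarrow> complex"
  assumes T: "0 < T" and v0: "in_hs 0 v0" and sol: "\<And>m. galerkin v0 m (vm m)"
  obtains r :: "nat \<Rightarrow> nat" where "strict_mono r"
    and "\<And>t k. t \<in> {0..T} \<Longrightarrow> k \<noteq> 0 \<Longrightarrow> convergent (\<lambda>j. vm (r j) t k)"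
proof -
  \<comment> \<open>A countable set of pairs of a rational time and a frequency; on it the modes are
    bounded by the conserved mass norm, so a diagonal argument gives one subsequence for all
    pairs.\<close>
  define S where "S = (\<rat> \<inter> {0..T}) \<times> Z0"
  have "countable S" unfolding S_def by (intro countable_SIGMA countable_Int1 countable_rat) auto
  then obtain r :: "nat \<Rightarrow> nat" where r: "strict_mono r"
    and lim: "\<And>q. q \<in> S \<Longrightarrow> \<exists>l. (\<lambda>j. (\<lambda>m (t, k). vm m t k) (r j) q) \<longlonglongrightarrow> l"
  proof (rule function_convergent_subsequence[of S "\<lambda>m (t, k). vm m t k" "hs_norm 0 v0"])
    fix m and q :: "real \<times> int" assume "q \<in> S"
    then show "norm ((\<lambda>m (t, k). vm m t k) m q) \<le> hs_norm 0 v0"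
      using galerkin.mode_le[OF sol v0] by (auto simp: S_def Z0_def)
  qed blast
  have "convergent (\<lambda>j. vm (r j) t k)" if t: "t \<in> {0..T}" and k: "k \<noteq> 0" for t k
  proof (rule Cauchy_convergent, rule metric_CauchyI)
    fix e :: real assume e: "0 < e"
    define C where "C = \<bar>real_of_int k\<bar> / 2 * (hs_norm 0 v0)\<^sup>2 + 1"
    have C: "0 < C" by (auto simp: C_def add_nonneg_pos)
    define d where "d = e / (4 * C)"
    have d: "0 < d" using e C by (simp add: d_def)
    \<comment> \<open>The interval is cut to stay inside the time range; it is nonempty even when
      \<open>t\<close> is 0 or \<open>T\<close>.\<close>
    have "max 0 (t - d) < min T (t + d)" using t d T by auto
    then obtain q where q: "q \<in> \<rat>" "max 0 (t - d) < q" "q < min T (t + d)"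
      using Rats_dense_in_real by blast
    have close: "dist (vm m t k) (vm m q k) \<le> e / 4" for m
    proof -
      have "dist (vm m t k) (vm m q k) \<le> \<bar>of_int k\<bar> / 2 * (hs_norm 0 v0)\<^sup>2 * \<bar>t - q\<bar>"
        unfolding dist_norm using galerkin.lipschitz[OF sol v0 k] t q by auto
      also have "\<dots> \<le> C * d" using q by (intro mult_mono) (auto simp: C_def)
      also have "\<dots> = e / 4" using C by (simp add: d_def)
      finally show ?thesis .
    qed
    have "(q, k) \<in> S" using q k by (auto simp: S_def Z0_def)
    then have "Cauchy (\<lambda>j. vm (r j) q k)" using lim[of "(q, k)"] by (auto intro: convergent_Cauchy convergentI)
    then obtain N where N: "\<And>i j. N \<le> i \<Longrightarrow> N \<le> j \<Longrightarrow> dist (vm (r i) q k) (vm (r j) q k) < e / 4"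
      using e unfolding Cauchy_def by (metis zero_less_divide_iff zero_less_numeral)
    have "dist (vm (r i) t k) (vm (r j) t k) < e" if "N \<le> i" "N \<le> j" for i j
    proof -
      have "dist (vm (r i) t k) (vm (r j) t k) \<le> dist (vm (r i) t k) (vm (r i) q k) +
         (dist (vm (r i) q k) (vm (r j) q k) + dist (vm (r j) t k) (vm (r j) q k))"
        using dist_triangle[of "vm (r i) t k" "vm (r j) t k" "vm (r i) q k"]
          dist_triangle[of "vm (r i) q k" "vm (r j) t k" "vm (r j) q k"]
          dist_commute[of "vm (r j) q k" "vm (r j) t k"] by linarith
      then show ?thesis using close[of "r i"] close[of "r j"] N[OF that] e by linarith
    qed
    then show "\<exists>M. \<forall>i\<ge>M. \<forall>j\<ge>M. dist (vm (r i) t k) (vm (r j) t k) < e" by blast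
  qed
  with r that show thesis by blast
qed

theorem theorem4p6:
  shows "\<exists>M :: real \<Rightarrow> real \<Rightarrow> real \<Rightarrow> real \<Rightarrow> real.
    \<forall>(s0::real) (v0 :: int \<Rightarrow> complex) (T::real) (\<sigma>::real) (vm :: nat \<Rightarrow> real \<Rightarrow> int \<Rightarrow> complex).
      s0 > 0 \<and> v0 \<in> Hdot s0 \<and> T > 0 \<and> 0 < \<sigma> \<and> \<sigma> < s0 \<and>
      (\<forall>m. galerkin_solution v0 m (vm m))
      \<longrightarrow>
      (\<exists>(r :: nat \<Rightarrow> nat) (vinf :: real \<Rightarrow> int \<Rightarrow> complex).
         strict_mono r \<and>
         (\<forall>p::real. 1 < p \<longrightarrow> Lp_converges T \<sigma> p (\<lambda>j. vm (r j)) vinf) \<and>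
         in_Linf T s0 vinf \<and>
         weakstar_converges T s0 (\<lambda>j. vm (r j)) vinf \<and>
         is_solution T v0 vinf \<and>
         (AE t in lborel. t \<in> {0..T} \<longrightarrow>
            hs_norm s0 (vinf t) \<le> M (hs_norm 0 v0) T (hs_norm s0 v0) s0) \<and>
         (AE t in lborel. t \<in> {0..T} \<longrightarrow> hs_norm 0 (vinf t) = hs_norm 0 v0))"
proof (rule exI[of _ "\<lambda>l T e s. sqrt (apriori_bound s T (l\<^sup>2) (e\<^sup>2) + e\<^sup>2)"], intro allI impI, elim conjE)
  fix s0 T \<sigma> :: real and v0 and vm :: "nat \<Rightarrow> real \<Rightarrow> int \<Rightarrow> complex"
  assume s0: "s0 > 0" and v0: "v0 \<in> Hdot s0" and T: "T > 0" and \<sigma>: "\<sigma> < s0"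
    and gal: "\<forall>m. galerkin_solution v0 m (vm m)"
  define B where "B = apriori_bound s0 T ((hs_norm 0 v0)\<^sup>2) ((hs_norm s0 v0)\<^sup>2) + (hs_norm s0 v0)\<^sup>2"
  have v0_s: "in_hs s0 v0" and v0_0: "in_hs 0 v0"
    using v0 s0 in_hs_mono[of 0 s0 v0] by (auto simp: Hdot_def)
  have sol: "galerkin v0 m (vm m)" for m
    using gal v0 by unfold_locales (auto simp: Hdot_def Z0_def)
  obtain r where r: "strict_mono r"
    and lim: "\<And>t k. t \<in> {0..T} \<Longrightarrow> k \<noteq> 0 \<Longrightarrow> convergent (\<lambda>j. vm (r j) t k)"
    using galerkin_convergent_subsequence[OF T v0_0 sol] by blast
  define V where "V = (\<lambda>t k. if k = 0 then 0 else Lim sequentially (\<lambda>j. vm (r j) t k))"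
  interpret galerkin_limit v0 s0 T B r "\<lambda>j. vm (r j)" V
  proof
    show "filterlim r at_top sequentially" using r by (rule filterlim_subseq)
    show "galerkin_solution v0 (r j) (vm (r j))" for j using gal by blast
    show "v0 (- k) = cnj (v0 k)" if "k \<noteq> 0" for k using v0 that by (auto simp: Hdot_def Z0_def)
    show "(\<Sum>k\<in>G. hs_weight s0 (vm (r j) t) k) \<le> B" if "t \<in> {0..T}" "finite G" "G \<subseteq> Z0" for t G j
      unfolding B_def using galerkin.hs_bound[OF sol] that s0 v0_s by auto
    show "(\<lambda>j. vm (r j) t k) \<longlonglongrightarrow> V t k" if "t \<in> {0..T}" "k \<noteq> 0" for t k
      using lim[OF that] that by (simp add: V_def convergent_LIMSEQ_iff)
  qed (use s0 T v0 in \<open>auto simp: V_def\<close>)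
  have Lp: "\<forall>p. 1 < p \<longrightarrow> Lp_converges T \<sigma> p (\<lambda>j. vm (r j)) V"
    using Lp_conv[OF \<sigma>] by simp
  have bound: "AE t in lborel. t \<in> {0..T} \<longrightarrow> hs_norm s0 (V t) \<le> sqrt B"
    using V_norm by (intro AE_I2 impI real_le_rsqrt)
  have mass: "AE t in lborel. t \<in> {0..T} \<longrightarrow> hs_norm 0 (V t) = hs_norm 0 v0"
    using V_mass by (intro AE_I2 impI)
  show "\<exists>r vinf. strict_mono r \<and>
         (\<forall>p. 1 < p \<longrightarrow> Lp_converges T \<sigma> p (\<lambda>j. vm (r j)) vinf) \<and>
         in_Linf T s0 vinf \<and>
         weakstar_converges T s0 (\<lambda>j. vm (r j)) vinf \<and>
         is_solution T v0 vinf \<and>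
         (AE t in lborel. t \<in> {0..T} \<longrightarrow>
            hs_norm s0 (vinf t) \<le> sqrt (apriori_bound s0 T ((hs_norm 0 v0)\<^sup>2) ((hs_norm s0 v0)\<^sup>2) + (hs_norm s0 v0)\<^sup>2)) \<and>
         (AE t in lborel. t \<in> {0..T} \<longrightarrow> hs_norm 0 (vinf t) = hs_norm 0 v0)"
    by (intro exI[of _ r] exI[of _ V] conjI r Lp Linf_s weakstar_conv V_solution bound[unfolded B_def] mass)
qed

end
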